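(* Let $\mathbb{X}$ be a non-degenerate set of $s$ points in generic position in $\mathbb{P}^{n_1}\times\cdots\times\mathbb{P}^{n_k}$. Then, with $\mathcal{D}$, $\mathbb{D}$ and $W_{\underline{j}}$ as defined in the context, $$\nu(I_{\mathbb{X}})=\sum_{\underline{i}\in\mathcal{D}}\dim_{\mathbf{k}}(I_{\mathbb{X}})_{\underline{i}}+\sum_{\underline{j}\in\mathbb{D}}\left(\dim_{\mathbf{k}}(I_{\mathbb{X}})_{\underline{j}}-\dim_{\mathbf{k}}W_{\underline{j}}\right)=\sum_{\underline{i}\in\mathcal{D}}\left(N(\underline{i})-s\right)+\sum_{\underline{j}\in\mathbb{D}}\left(N(\underline{j})-s-\dim_{\mathbf{k}}W_{\underline{j}}\right).$$
   Context: $\mathbf{k}$ is an algebraically closed field of characteristic $0$; $\mathbb{N}=\{0,1,2,\ldots\}$; $k\ge 1$ and $n_1,\ldots,n_k\ge 1$ are integers; $[k]=\{1,\ldots,k\}$; $e_1,\ldots,e_k$ is the standard basis of $\mathbb{N}^k$; $\mathbb{N}^k$ is partially ordered coordinatewise, and $\min\mathcal{S}$ denotes the set of minimal elements of $\mathcal{S}\subseteq\mathbb{N}^k$. $R=\mathbf{k}[x_{l,m} : 1\le l\le k,\ 0\le m\le n_l]$ is $\mathbb{N}^k$-graded by $\deg x_{l,m}=e_l$; it is the coordinate ring of $\mathbb{P}^{n_1}\times\cdots\times\mathbb{P}^{n_k}$ over $\mathbf{k}$. $N(\underline{i})=\dim_{\mathbf{k}}R_{\underline{i}}=\prod_{l=1}^k\binom{n_l+i_l}{i_l}$.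 For a nonempty finite set $\mathbb{X}$ of points, $I_{\mathbb{X}}\subseteq R$ is the ideal generated by the $\mathbb{N}^k$-homogeneous forms vanishing at every point of $\mathbb{X}$, $H_{\mathbb{X}}(\underline{i})=\dim_{\mathbf{k}}(R/I_{\mathbb{X}})_{\underline{i}}$, and $\nu(I_{\mathbb{X}})$ is the minimal number of generators of $I_{\mathbb{X}}$. A set $\mathbb{X}$ of $s$ (distinct) points is in generic position if $H_{\mathbb{X}}(\underline{i})=\min\{N(\underline{i}),s\}$ for all $\underline{i}\in\mathbb{N}^k$; it is non-degenerate if $s>\max\{n_1,\ldots,n_k\}$. Set $\mathcal{D}=\min\{\underline{i}\in\mathbb{N}^k\mid N(\underline{i})>s\}$ and $\mathcal{D}+e_l=\{\underline{i}+e_l\mid\underline{i}\in\mathcal{D}\}$. For $\underline{i}\in\mathcal{D}$ set $\mathbb{D}_{\underline{i}}=\{\underline{j}\in\mathbb{N}^k\mid\underline{j}\ge\underline{i}\}\setminus\{\underline{i},\underline{i}+e_1,\ldots,\underline{i}+e_k\}$, and set $\mathbb{D}=\left[\bigcup_{l=1}^k(\mathcal{D}+e_l)\right]\setminus\left[\bigcup_{\underline{i}\in\mathcal{D}}\mathbb{D}_{\underline{i}}\right]$. For $\underline{j}\in\mathbb{D}$ let $L_{\underline{j}}=\{l\in[k]\mid\underline{j}\in\mathcal{D}+e_l\}$ and $W_{\underline{j}}=\sum_{l\in L_{\underline{j}}}R_{e_l}(I_{\mathbb{X}})_{\underline{j}-e_l}\subseteq(I_{\mathbb{X}})_{\underline{j}}$,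 where $R_{e_l}(I_{\mathbb{X}})_{\underline{i}}=\{f_0x_{l,0}+\cdots+f_{n_l}x_{l,n_l}\mid f_h\in(I_{\mathbb{X}})_{\underline{i}}\}$. *)

theory Defs
  imports
    Complex_Main
    "HOL-Library.FuncSet"
    "HOL-Library.Poly_Mapping"
    "HOL-Library.Function_Algebras"
    "HOL-Computational_Algebra.Polynomial"
begin

text \<open>
  The factors of the product of projective spaces are indexed by a nonempty finite type
  \<^typ>\<open>'k\<close> (of cardinality $k$), so that $\mathbb{N}^k$ is the type of functions from \<^typ>\<open>'k\<close>
  to \<^typ>\<open>nat\<close> with its pointwise order, addition and subtraction.  The dimensions are
  \<open>n :: 'k \<Rightarrow> nat\<close>.  The variable $x_{l,m}$ is the pair \<open>(l, m)\<close>, and only the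
  pairs with \<open>m \<le> n l\<close> belong to $R$; hence $R$ is a subring of the ring of all polynomials in
  variables from \<open>'k \<times> nat\<close>.
\<close>

type_synonym 'k monom = "('k \<times> nat) \<Rightarrow>\<^sub>0 nat"
type_synonym ('k, 'a) mpoly = "(('k \<times> nat) \<Rightarrow>\<^sub>0 nat) \<Rightarrow>\<^sub>0 'a"

definition std_basis :: "'k \<Rightarrow> ('k \<Rightarrow> nat)" where
  "std_basis l = (\<lambda>l'. if l' = l then 1 else 0)"

definition minimals :: "('k \<Rightarrow> nat) set \<Rightarrow> ('k \<Rightarrow> nat) set" where
  "minimals S = {i \<in> S. \<forall>j \<in> S. j \<le> i \<longrightarrow> j = i}"


subsection \<open>The multigraded polynomial ring\<close>

definition Vars :: "('k \<Rightarrow> nat) \<Rightarrow> ('k \<times> nat) set" where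
  "Vars n = {(l, m). m \<le> n l}"

definition polyring :: "('k \<Rightarrow> nat) \<Rightarrow> ('k, 'a::zero) mpoly set" where
  "polyring n = {f. \<forall>t \<in> Poly_Mapping.keys f. Poly_Mapping.keys t \<subseteq> Vars n}"

definition var :: "'k \<Rightarrow> nat \<Rightarrow> ('k, 'a::zero_neq_one) mpoly" where
  "var l m = Poly_Mapping.single (Poly_Mapping.single (l, m) 1) 1"

definition mdeg :: "('k \<Rightarrow> nat) \<Rightarrow> 'k monom \<Rightarrow> ('k \<Rightarrow> nat)" where
  "mdeg n t = (\<lambda>l. \<Sum>m\<le>n l. Poly_Mapping.lookup t (l, m))"

definition graded :: "('k \<Rightarrow> nat) \<Rightarrow> ('k \<Rightarrow> nat) \<Rightarrow> ('k, 'a::zero) mpoly set" where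
  "graded n i = {f \<in> polyring n. \<forall>t \<in> Poly_Mapping.keys f. mdeg n t = i}"

definition scale :: "'a::comm_ring_1 \<Rightarrow> ('k, 'a) mpoly \<Rightarrow> ('k, 'a) mpoly" where
  "scale c f = Poly_Mapping.single 0 c * f"

global_interpretation mpoly_vs: vector_space "scale :: 'a::field \<Rightarrow> ('k, 'a) mpoly \<Rightarrow> ('k, 'a) mpoly"
  by unfold_locales
    (simp_all add: scale_def distrib_left distrib_right single_add mult_single
      mult.assoc[symmetric])

text \<open>
  The dimension of the image of a subspace \<open>V\<close> in the quotient by a subspace \<open>W\<close>: the size of a
  finite set \<open>B \<subseteq> V\<close> whose classes modulo \<open>W\<close> form a basis of that image.
\<close>

definition quot_basis :: "('k, 'a::field) mpoly set \<Rightarrow> ('k, 'a) mpoly set \<Rightarrow> ('k, 'a) mpoly set \<Rightarrow> bool" where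
  "quot_basis V W B \<longleftrightarrow> finite B \<and> B \<subseteq> V \<and>
     (\<forall>f\<in>V. \<exists>c. f - (\<Sum>b\<in>B. scale (c b) b) \<in> W) \<and>
     (\<forall>c. (\<Sum>b\<in>B. scale (c b) b) \<in> W \<longrightarrow> (\<forall>b\<in>B. c b = 0))"

definition quot_dim :: "('k, 'a::field) mpoly set \<Rightarrow> ('k, 'a) mpoly set \<Rightarrow> nat" where
  "quot_dim V W = (THE d. \<exists>B. quot_basis V W B \<and> card B = d)"

definition ideal_generated :: "('k \<Rightarrow> nat) \<Rightarrow> ('k, 'a::comm_ring_1) mpoly set \<Rightarrow> ('k, 'a) mpoly set" where
  "ideal_generated n G =
     {(\<Sum>g\<in>F. c g * g) | F c. finite F \<and> F \<subseteq> G \<and> (\<forall>g\<in>F. c g \<in> polyring n)}"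

text \<open>The generators are not required to be homogeneous.\<close>

definition min_gens :: "('k \<Rightarrow> nat) \<Rightarrow> ('k, 'a::comm_ring_1) mpoly set \<Rightarrow> nat" where
  "min_gens n I =
     (LEAST r. \<exists>G. finite G \<and> G \<subseteq> polyring n \<and> card G = r \<and> ideal_generated n G = I)"


subsection \<open>Points in a product of projective spaces\<close>

definition punctured :: "nat \<Rightarrow> (nat \<Rightarrow> 'a::field) set" where
  "punctured d = {v. (\<exists>m\<le>d. v m \<noteq> 0) \<and> (\<forall>m>d. v m = 0)}"

definition proportional :: "nat \<Rightarrow> ((nat \<Rightarrow> 'a::field) \<times> (nat \<Rightarrow> 'a)) set" where
  "proportional d =
     {(v, w). v \<in> punctured d \<and> w \<in> punctured d \<and> (\<exists>c. c \<noteq> 0 \<and> (\<forall>m. w m = c * v m))}"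

definition proj_space :: "nat \<Rightarrow> (nat \<Rightarrow> 'a::field) set set" where
  "proj_space d = punctured d // proportional d"

definition multiproj :: "('k \<Rightarrow> nat) \<Rightarrow> ('k \<Rightarrow> (nat \<Rightarrow> 'a::field) set) set" where
  "multiproj n = {P. \<forall>l. P l \<in> proj_space (n l)}"

definition eval_at :: "('k \<Rightarrow> nat \<Rightarrow> 'a::comm_ring_1) \<Rightarrow> ('k, 'a) mpoly \<Rightarrow> 'a" where
  "eval_at v f = (\<Sum>t\<in>Poly_Mapping.keys f. Poly_Mapping.lookup f t *
      (\<Prod>(l, m)\<in>Poly_Mapping.keys t. v l m ^ Poly_Mapping.lookup t (l, m)))"

definition vanishes_at :: "('k, 'a::field) mpoly \<Rightarrow> ('k \<Rightarrow> (nat \<Rightarrow> 'a) set) \<Rightarrow> bool" where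
  "vanishes_at f P \<longleftrightarrow> (\<forall>v. (\<forall>l. v l \<in> P l) \<longrightarrow> eval_at v f = 0)"

definition point_ideal ::
  "('k \<Rightarrow> nat) \<Rightarrow> ('k \<Rightarrow> (nat \<Rightarrow> 'a::field) set) set \<Rightarrow> ('k, 'a) mpoly set" where
  "point_ideal n X = ideal_generated n {f. (\<exists>i. f \<in> graded n i) \<and> (\<forall>P\<in>X. vanishes_at f P)}"

definition point_ideal_part ::
  "('k \<Rightarrow> nat) \<Rightarrow> ('k \<Rightarrow> (nat \<Rightarrow> 'a::field) set) set \<Rightarrow> ('k \<Rightarrow> nat) \<Rightarrow> ('k, 'a) mpoly set" where
  "point_ideal_part n X i = point_ideal n X \<inter> graded n i"

text \<open>
  $(R/I_X)_i$ is the image of $R_i$ in $R/I_X$.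
\<close>

definition hilbert_fun ::
  "('k \<Rightarrow> nat) \<Rightarrow> ('k \<Rightarrow> (nat \<Rightarrow> 'a::field) set) set \<Rightarrow> ('k \<Rightarrow> nat) \<Rightarrow> nat" where
  "hilbert_fun n X i = quot_dim (graded n i) (point_ideal n X)"

text \<open>
  This is the dimension of the graded piece of degree \<open>i\<close>, see \<open>dim_graded\<close> below.
\<close>

definition NN :: "('k::finite \<Rightarrow> nat) \<Rightarrow> ('k \<Rightarrow> nat) \<Rightarrow> nat" where
  "NN n i = (\<Prod>l\<in>UNIV. (n l + i l) choose i l)"

definition generic_position ::
  "('k::finite \<Rightarrow> nat) \<Rightarrow> ('k \<Rightarrow> (nat \<Rightarrow> 'a::field) set) set \<Rightarrow> bool" where
  "generic_position n X \<longleftrightarrow> (\<forall>i. hilbert_fun n X i = min (NN n i) (card X))"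

definition non_degenerate ::
  "('k::finite \<Rightarrow> nat) \<Rightarrow> ('k \<Rightarrow> (nat \<Rightarrow> 'a::field) set) set \<Rightarrow> bool" where
  "non_degenerate n X \<longleftrightarrow> card X > Max (range n)"


subsection \<open>The degrees and subspaces in the generator count\<close>

definition DD :: "('k::finite \<Rightarrow> nat) \<Rightarrow> nat \<Rightarrow> ('k \<Rightarrow> nat) set" where
  "DD n s = minimals {i. NN n i > s}"

definition DD_shift :: "('k::finite \<Rightarrow> nat) \<Rightarrow> nat \<Rightarrow> 'k \<Rightarrow> ('k \<Rightarrow> nat) set" where
  "DD_shift n s l = {i + std_basis l | i. i \<in> DD n s}"

definition excluded :: "('k \<Rightarrow> nat) \<Rightarrow> ('k \<Rightarrow> nat) set" where
  "excluded i = {j. i \<le> j} - ({i} \<union> {i + std_basis l | l. True})"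

definition BD :: "('k::finite \<Rightarrow> nat) \<Rightarrow> nat \<Rightarrow> ('k \<Rightarrow> nat) set" where
  "BD n s = (\<Union>l. DD_shift n s l) - (\<Union>i\<in>DD n s. excluded i)"

definition LL :: "('k::finite \<Rightarrow> nat) \<Rightarrow> nat \<Rightarrow> ('k \<Rightarrow> nat) \<Rightarrow> 'k set" where
  "LL n s j = {l. j \<in> DD_shift n s l}"

definition mult_part ::
  "('k \<Rightarrow> nat) \<Rightarrow> ('k \<Rightarrow> (nat \<Rightarrow> 'a::field) set) set \<Rightarrow> 'k \<Rightarrow> ('k \<Rightarrow> nat) \<Rightarrow> ('k, 'a) mpoly set" where
  "mult_part n X l i =
     {(\<Sum>h\<le>n l. f h * var l h) | f. \<forall>h\<le>n l. f h \<in> point_ideal_part n X i}"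

definition WW ::
  "('k::finite \<Rightarrow> nat) \<Rightarrow> ('k \<Rightarrow> (nat \<Rightarrow> 'a::field) set) set \<Rightarrow> ('k \<Rightarrow> nat) \<Rightarrow> ('k, 'a) mpoly set" where
  "WW n X j =
     {(\<Sum>l\<in>LL n (card X) j. w l) | w.
        \<forall>l\<in>LL n (card X) j. w l \<in> mult_part n X l (j - std_basis l)}"


subsection \<open>The dimension of a graded piece\<close>

lemma graded_alt:
  "graded n i = {f. \<forall>t\<in>Poly_Mapping.keys f. Poly_Mapping.keys t \<subseteq> Vars n \<and> mdeg n t = i}"
  by (auto simp: graded_def polyring_def)

lemma card_monomials:
  fixes n i :: "'k::finite \<Rightarrow> nat"
  defines "M \<equiv> {t. Poly_Mapping.keys t \<subseteq> Vars n \<and> mdeg n t = i}"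
  shows "card M = NN n i" "finite M"
proof -
  define T where "T = (\<lambda>l. {xs::nat list. length xs = n l + 1 \<and> sum_list xs = i l})"
  define \<phi> where "\<phi> = (\<lambda>(t::'k monom) l. map (\<lambda>m. Poly_Mapping.lookup t (l, m)) [0..<n l + 1])"
  have S: "sum_list (\<phi> t l) = mdeg n t l" for t l
    by (simp only: \<phi>_def mdeg_def interv_sum_list_conv_sum_set_nat)
      (simp add: atLeast0LessThan add.commute flip: lessThan_Suc_atMost)
  have cardT: "card (T l) = (n l + i l) choose i l" for l
    using card_length_sum_list[of "n l + 1" "i l"] by (simp add: T_def add.commute)
  have finT: "finite (T l)" for l
    using cardT[of l] by (intro card_ge_0_finite) simp
  have bij: "bij_betw \<phi> M (PiE UNIV T)"
  proof (rule bij_betw_imageI)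
    show "inj_on \<phi> M"
    proof (rule inj_onI, rule poly_mapping_eqI)
      fix t u :: "'k monom" and p :: "'k \<times> nat" assume t: "t \<in> M" and u: "u \<in> M" and eq: "\<phi> t = \<phi> u"
      obtain l m where p: "p = (l, m)" by (cases p)
      show "Poly_Mapping.lookup t p = Poly_Mapping.lookup u p"
      proof (cases "m \<le> n l")
        case True
        have "\<phi> t l ! m = \<phi> u l ! m" using eq by simp
        with True show ?thesis by (simp add: \<phi>_def p del: upt_Suc)
      next
        case False
        hence "p \<notin> Vars n" by (simp add: p Vars_def)
        hence "p \<notin> Poly_Mapping.keys t" "p \<notin> Poly_Mapping.keys u"
          using t u by (auto simp: M_def)
        thus ?thesis by (simp add: in_keys_iff)
      qed
    qed
    show "\<phi> ` M = PiE UNIV T"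
    proof (intro equalityI subsetI)
      fix g assume "g \<in> \<phi> ` M"
      then obtain t where "t \<in> M" "g = \<phi> t" by auto
      thus "g \<in> PiE UNIV T"
        using S[of t] by (auto simp: T_def M_def PiE_def Pi_def \<phi>_def simp del: upt_Suc)
    next
      fix g assume g: "g \<in> PiE UNIV T"
      define r where "r = (\<lambda>(l, m). if m \<le> n l then g l ! m else 0)"
      have finV: "finite (Vars n)"
      proof -
        have "Vars n = (SIGMA l:UNIV. {..n l})" by (auto simp: Vars_def)
        thus ?thesis by simp
      qed
      have sub: "{p. r p \<noteq> 0} \<subseteq> Vars n" by (auto simp: r_def Vars_def split: if_splits)
      have lk: "Poly_Mapping.lookup (Abs_poly_mapping r) = r"
        by (rule lookup_Abs_poly_mapping) (rule finite_subset[OF sub finV])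
      have lk': "Poly_Mapping.lookup (Abs_poly_mapping r) (l, m) = (if m \<le> n l then g l ! m else 0)"
        for l m unfolding lk by (simp add: r_def)
      have len: "length (g l) = n l + 1" and sm: "sum_list (g l) = i l" for l
        using g by (auto simp: T_def PiE_def)
      have ph: "\<phi> (Abs_poly_mapping r) l = g l" for l
        by (rule nth_equalityI) (use len in \<open>auto simp: \<phi>_def lk' simp del: upt_Suc\<close>)
      have "Abs_poly_mapping r \<in> M"
      proof -
        have "Poly_Mapping.keys (Abs_poly_mapping r) \<subseteq> Vars n"
          using sub by (auto simp: in_keys_iff lk)
        moreover have "mdeg n (Abs_poly_mapping r) = i"
          using S[of "Abs_poly_mapping r"] ph sm by (auto simp: fun_eq_iff)
        ultimately show ?thesis by (simp add: M_def)
      qed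
      moreover have "\<phi> (Abs_poly_mapping r) = g" using ph by auto
      ultimately show "g \<in> \<phi> ` M" by auto
    qed
  qed
  have "card M = card (PiE UNIV T)" by (rule bij_betw_same_card[OF bij])
  also have "\<dots> = NN n i" by (simp add: card_PiE cardT NN_def)
  finally show "card M = NN n i" .
  show "finite M"
    using bij_betw_finite[OF bij] finT by (simp add: finite_PiE)
qed

lemma lookup_scale: "Poly_Mapping.lookup (scale c f) t = c * Poly_Mapping.lookup f t"
  by (simp add: scale_def lookup_mult lookup_single when_mult)

lemma dim_graded:
  fixes n i :: "'k::finite \<Rightarrow> nat"
  shows "mpoly_vs.dim (graded n i :: ('k, 'a::field) mpoly set) = NN n i"
proof -
  define M where "M = {t :: 'k monom. Poly_Mapping.keys t \<subseteq> Vars n \<and> mdeg n t = i}"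
  define e where "e = (\<lambda>t::'k monom. Poly_Mapping.single t (1::'a))"
  note M = card_monomials[of n i, folded M_def]
  have inj: "inj_on e M" by (auto simp: inj_on_def e_def dest!: arg_cong[where f = Poly_Mapping.keys])
  have lke: "Poly_Mapping.lookup (\<Sum>t\<in>M. scale (c t) (e t)) u = (if u \<in> M then c u else 0)" for c u
  proof -
    have "Poly_Mapping.lookup (\<Sum>t\<in>M. scale (c t) (e t)) u
        = (\<Sum>t\<in>M. if t = u then c t else 0)"
      by (simp add: lookup_sum lookup_scale e_def lookup_single when_def if_distrib cong: if_cong)
    thus ?thesis using M by simp
  qed
  have sub: "e ` M \<subseteq> graded n i" by (auto simp: e_def M_def graded_alt)
  have "graded n i \<subseteq> mpoly_vs.span (e ` M)"
  proof
    fix f :: "('k, 'a) mpoly" assume f: "f \<in> graded n i"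
    have "f = (\<Sum>t\<in>M. scale (Poly_Mapping.lookup f t) (e t))"
    proof (rule poly_mapping_eqI)
      fix u show "Poly_Mapping.lookup f u
          = Poly_Mapping.lookup (\<Sum>t\<in>M. scale (Poly_Mapping.lookup f t) (e t)) u"
        unfolding lke using f by (auto simp: graded_alt M_def in_keys_iff)
    qed
    also have "\<dots> \<in> mpoly_vs.span (e ` M)"
      by (intro mpoly_vs.span_sum mpoly_vs.span_scale mpoly_vs.span_base) auto
    finally show "f \<in> mpoly_vs.span (e ` M)" .
  qed
  moreover have "mpoly_vs.independent (e ` M)"
  proof (rule mpoly_vs.independent_if_scalars_zero)
    show "finite (e ` M)" using M by simp
    fix c x assume z: "(\<Sum>x\<in>e ` M. scale (c x) x) = 0" and x: "x \<in> e ` M"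
    have "(\<Sum>t\<in>M. scale (c (e t)) (e t)) = 0" using z by (simp add: sum.reindex[OF inj])
    moreover obtain t where "t \<in> M" "x = e t" using x by auto
    ultimately show "c x = 0" using lke[of "\<lambda>t. c (e t)" t] by simp
  qed
  ultimately have "mpoly_vs.dim (graded n i :: ('k, 'a) mpoly set) = card (e ` M)"
    using sub by (intro mpoly_vs.dim_unique[where B = "e ` M"]) auto
  thus ?thesis using M inj by (simp add: card_image)
qed

end

theory Submission
  imports Defs
begin

text \<open>
  Let \<open>I\<close> be the ideal of \<open>X\<close> and \<open>R\<^sub>+\<close> the ideal of all variables.  By graded Nakayama the minimal
  number of generators of \<open>I\<close> is the sum over all degrees \<open>j\<close> of the dimension of
  \<open>I\<^sub>j / (R\<^sub>+ I)\<^sub>j\<close>, so it remains to see in which degrees this quotient can be nonzero.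
  Generic position gives \<open>I\<^sub>j = 0\<close> when \<open>N(j) \<le> s\<close>, which settles the minimal degrees \<open>\<D>\<close> and
  identifies \<open>(R\<^sub>+ I)\<^sub>j\<close> with \<open>W\<^sub>j\<close> on the second set of degrees.  Every other degree with \<open>N(j) > s\<close> has the form
  \<open>j = i + e\<^sub>l + e\<^sub>m\<close> with \<open>N(i) > s\<close>.  Choose linear forms \<open>g\<close>, \<open>h\<close> of degrees \<open>e\<^sub>l\<close>, \<open>e\<^sub>m\<close> that
  vanish at no point of \<open>X\<close>.  Multiplication by either is injective on \<open>R / I\<close>, hence bijective between
  graded pieces of dimension \<open>s\<close>; two applications give \<open>R\<^sub>j = (R\<^sub>+ I)\<^sub>j + g h R\<^sub>i\<close>, and an element of
  \<open>I\<^sub>j\<close> has its cofactor of \<open>g h\<close> in \<open>I\<^sub>i\<close>, so \<open>I\<^sub>j = (R\<^sub>+ I)\<^sub>j\<close>.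
\<close>

subsection \<open>Linear independence modulo a subspace\<close>

text \<open>Independence of classes modulo \<open>U\<close>, phrased with representatives so that no
  quotient space has to be formed; distinct elements of \<open>B\<close> then also have distinct
  classes.\<close>

definition (in vector_space) indep_mod :: "'b set \<Rightarrow> 'b set \<Rightarrow> bool" where
  "indep_mod U B \<longleftrightarrow> finite B \<and> (\<forall>c. (\<Sum>b\<in>B. scale (c b) b) \<in> U \<longrightarrow> (\<forall>b\<in>B. c b = 0))"

lemma (in vector_space) indep_mod_zero_notin:
  assumes "indep_mod U B" "subspace U"
  shows "0 \<notin> B"
proof
  assume B: "0 \<in> B"
  have "(\<Sum>b\<in>B. scale (if b = 0 then 1 else 0) b) = 0"
    by (rule sum.neutral) auto
  then have "(\<Sum>b\<in>B. scale (if b = 0 then 1 else 0) b) \<in> U"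
    using assms(2) by (simp add: subspace_0)
  with assms(1) have "\<forall>b\<in>B. (if b = 0 then 1 else 0 :: 'a) = 0"
    unfolding indep_mod_def by (auto dest!: spec[of _ "\<lambda>b. if b = 0 then 1 else 0"])
  from bspec[OF this B] show False by simp
qed

text \<open>In a relation on \<open>B \<union> C\<close> the \<open>B\<close>-part lies in
  \<open>U\<close>, because \<open>C \<subseteq> U\<close>; so its coefficients vanish, and
  independence of \<open>C\<close> kills the rest. This turns counting modulo \<open>U\<close> into
  ordinary dimension counting.\<close>

lemma (in vector_space) indep_mod_union_basis:
  assumes B: "indep_mod U B" and U: "subspace U" and C: "C \<subseteq> U" "independent C" "finite C"
  shows "independent (B \<union> C)" "B \<inter> C = {}"
proof -
  have fB: "finite B" using B by (simp add: indep_mod_def)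
  have coeff: "c b = 0" if "(\<Sum>b\<in>B. scale (c b) b) \<in> U" "b \<in> B" for c b
    using B that by (simp add: indep_mod_def)
  show disj: "B \<inter> C = {}"
  proof (rule ccontr)
    assume "B \<inter> C \<noteq> {}"
    then obtain x where x: "x \<in> B" "x \<in> C" by auto
    have "(\<Sum>b\<in>B. scale (if b = x then 1 else 0) b) = (\<Sum>b\<in>B. if b = x then b else 0)"
      by (rule sum.cong) auto
    then have "(\<Sum>b\<in>B. scale (if b = x then 1 else 0) b) \<in> U"
      using fB x C by auto
    from coeff[OF this x(1)] show False by simp
  qed
  show "independent (B \<union> C)"
  proof (rule independent_if_scalars_zero)
    show "finite (B \<union> C)" using fB C by simp
    fix c x assume z: "(\<Sum>x\<in>B \<union> C. scale (c x) x) = 0" and x: "x \<in> B \<union> C"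
    have z': "(\<Sum>x\<in>B. scale (c x) x) + (\<Sum>x\<in>C. scale (c x) x) = 0"
      using z fB C disj by (simp add: sum.union_disjoint)
    have inU: "(\<Sum>x\<in>C. scale (c x) x) \<in> U"
      using C U by (intro subspace_sum subspace_scale) auto
    have "(\<Sum>x\<in>B. scale (c x) x) = - (\<Sum>x\<in>C. scale (c x) x)"
      using z' by (simp add: eq_neg_iff_add_eq_0)
    then have cB: "c b = 0" if "b \<in> B" for b
      using coeff[of c b] that inU U by (simp add: subspace_neg)
    then have "(\<Sum>x\<in>C. scale (c x) x) = 0" using z' by simp
    then have "c b = 0" if "b \<in> C" for b
      using independentD[OF C(2,3)] that by blast
    with cB x show "c x = 0" by blast
  qed
qed

lemma (in vector_space) indep_mod_image:
  assumes B: "finite B" and U: "subspace U"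
    and coeff: "\<And>c b. (\<Sum>b\<in>B. scale (c b) (g b)) \<in> U \<Longrightarrow> b \<in> B \<Longrightarrow> c b = 0"
  shows "inj_on g B" "indep_mod U (g ` B)"
proof -
  show inj: "inj_on g B"
  proof (rule inj_onI, rule ccontr)
    fix x y assume xy: "x \<in> B" "y \<in> B" "g x = g y" "x \<noteq> y"
    \<comment> \<open>Two elements with the same image would give a relation with coefficients 1 and
      -1.\<close>
    define c :: "_ \<Rightarrow> 'a" where "c = (\<lambda>b. if b = x then 1 else if b = y then - 1 else 0)"
    have "(\<Sum>b\<in>B. scale (c b) (g b)) = (\<Sum>b\<in>{x, y}. scale (c b) (g b))"
      by (rule sum.mono_neutral_right) (use xy B in \<open>auto simp: c_def\<close>)
    also have "\<dots> = 0" using xy by (simp add: c_def)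
    finally have "(\<Sum>b\<in>B. scale (c b) (g b)) \<in> U" using U by (simp add: subspace_0)
    from coeff[OF this xy(1)] show False by (simp add: c_def)
  qed
  show "indep_mod U (g ` B)"
    unfolding indep_mod_def
  proof (intro conjI allI impI ballI)
    fix c x assume "(\<Sum>x\<in>g ` B. scale (c x) x) \<in> U" "x \<in> g ` B"
    then show "c x = 0"
      using coeff[of "\<lambda>b. c (g b)"] by (auto simp: sum.reindex[OF inj])
  qed (use B in simp)
qed

lemma (in vector_space) finite_basis_exists:
  assumes "V \<subseteq> span F" "finite F"
  obtains C where "C \<subseteq> V" "independent C" "V \<subseteq> span C" "card C = dim V" "finite C"
proof -
  obtain C where C: "C \<subseteq> V" "independent C" "V \<subseteq> span C" "card C = dim V"
    using basis_exists[of V] by blast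
  have "finite C"
    using independent_span_bound[OF assms(2) C(2)] C(1) assms(1) by blast
  with C that show ?thesis by blast
qed

text \<open>Extend a basis \<open>C\<close> of \<open>U\<close> to a basis \<open>D\<close> of
  \<open>V\<close>; the added vectors \<open>D - C\<close> are the wanted set.\<close>

lemma (in vector_space) indep_mod_exists:
  assumes U: "subspace U" "U \<subseteq> V" and V: "V \<subseteq> span F" "finite F"
  obtains B where "B \<subseteq> V" "indep_mod U B" "card B + dim U = dim V"
proof -
  obtain C where C: "C \<subseteq> U" "independent C" "U \<subseteq> span C" "card C = dim U" "finite C"
    using finite_basis_exists[of U F] U V by blast
  obtain D where D: "C \<subseteq> D" "D \<subseteq> V" "independent D" "V \<subseteq> span D"
    using maximal_independent_subset_extend[of C V] C U by blast
  have fD: "finite D"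
    using independent_span_bound[OF V(2) D(3)] D(2) V(1) by blast
  have "indep_mod U (D - C)"
    unfolding indep_mod_def
  proof (intro conjI allI impI ballI)
    show "finite (D - C)" using fD by simp
    fix c b assume s: "(\<Sum>b\<in>D - C. scale (c b) b) \<in> U" and b: "b \<in> D - C"
    then obtain d where d: "(\<Sum>b\<in>D - C. scale (c b) b) = (\<Sum>x\<in>C. scale (d x) x)"
      using C(3) span_finite[OF C(5)] by auto
    \<comment> \<open>Moving the expansion over \<open>C\<close> to the other side leaves a single
      relation on the basis \<open>D\<close>.\<close>
    define e where "e = (\<lambda>x. if x \<in> C then - d x else c x)"
    have "(\<Sum>x\<in>D. scale (e x) x) = (\<Sum>x\<in>D - C. scale (e x) x) + (\<Sum>x\<in>C. scale (e x) x)"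
      using fD D by (simp add: sum.subset_diff)
    also have "(\<Sum>x\<in>D - C. scale (e x) x) = (\<Sum>b\<in>D - C. scale (c b) b)"
      by (rule sum.cong) (auto simp: e_def)
    also have "(\<Sum>x\<in>C. scale (e x) x) = - (\<Sum>x\<in>C. scale (d x) x)"
      by (auto simp: e_def sum_negf[symmetric] intro!: sum.cong)
    finally have "(\<Sum>x\<in>D. scale (e x) x) = 0" using d by simp
    then have "e b = 0" using independentD[OF D(3) fD order_refl] b by blast
    with b show "c b = 0" by (simp add: e_def)
  qed
  moreover have "card (D - C) + dim U = dim V"
    using D C fD basis_card_eq_dim[of D V] card_mono[OF fD D(1)] by (simp add: card_Diff_subset)
  ultimately show ?thesis using that D by blast
qed

lemma (in vector_space) indep_mod_card_spanning:
  assumes U: "subspace U" "U \<subseteq> V" and V: "V \<subseteq> span F" "finite F"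
    and B: "indep_mod U B" "B \<subseteq> V"
    and sp: "\<And>v. v \<in> V \<Longrightarrow> \<exists>c. v - (\<Sum>b\<in>B. scale (c b) b) \<in> U"
  shows "card B + dim U = dim V"
proof -
  obtain C where C: "C \<subseteq> U" "independent C" "U \<subseteq> span C" "card C = dim U" "finite C"
    using finite_basis_exists[of U F] U V by blast
  note BC = indep_mod_union_basis[OF B(1) U(1) C(1,2,5)]
  have fB: "finite B" using B by (simp add: indep_mod_def)
  have "V \<subseteq> span (B \<union> C)"
  proof
    fix v assume "v \<in> V"
    then obtain c where c: "v - (\<Sum>b\<in>B. scale (c b) b) \<in> U" using sp by blast
    have "(\<Sum>b\<in>B. scale (c b) b) \<in> span (B \<union> C)"
      by (intro span_sum span_scale span_base) auto
    moreover have "v - (\<Sum>b\<in>B. scale (c b) b) \<in> span (B \<union> C)"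
      using c C(3) span_mono[of C "B \<union> C"] by blast
    ultimately have "(\<Sum>b\<in>B. scale (c b) b) + (v - (\<Sum>b\<in>B. scale (c b) b)) \<in> span (B \<union> C)"
      by (rule span_add)
    then show "v \<in> span (B \<union> C)" by simp
  qed
  then have "card (B \<union> C) = dim V"
    using BC(1) B(2) C(1) U(2) by (intro basis_card_eq_dim) auto
  then show ?thesis using C fB BC(2) by (simp add: card_Un_disjoint)
qed

text \<open>Together with a basis of \<open>U\<close>, the set \<open>B\<close> is independent and
  has at least \<open>dim V\<close> elements; a vector of \<open>V\<close> outside its span would
  give an independent set that is too large.\<close>

lemma (in vector_space) indep_mod_spanning:
  assumes U: "subspace U" "U \<subseteq> V" and V: "V \<subseteq> span F" "finite F"
    and B: "indep_mod U B" "B \<subseteq> V" and card: "dim V \<le> card B + dim U" and v: "v \<in> V"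
  obtains c where "v - (\<Sum>b\<in>B. scale (c b) b) \<in> U"
proof -
  obtain C where C: "C \<subseteq> U" "independent C" "U \<subseteq> span C" "card C = dim U" "finite C"
    using finite_basis_exists[of U F] U V by blast
  obtain D where D: "D \<subseteq> V" "independent D" "V \<subseteq> span D" "card D = dim V" "finite D"
    using finite_basis_exists[of V F] V by blast
  note BC = indep_mod_union_basis[OF B(1) U(1) C(1,2,5)]
  have fB: "finite B" using B by (simp add: indep_mod_def)
  have cBC: "card (B \<union> C) = card B + dim U"
    using C fB BC(2) by (simp add: card_Un_disjoint)
  have "v \<in> span (B \<union> C)"
  proof (rule ccontr)
    assume nv: "v \<notin> span (B \<union> C)"
    then have nv': "v \<notin> B \<union> C" using span_base by blast
    have "independent (insert v (B \<union> C))"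
      using nv BC(1) by (simp add: independent_insert)
    moreover have "insert v (B \<union> C) \<subseteq> span D"
      using v B(2) C(1) U(2) D(3) by blast
    ultimately have "card (insert v (B \<union> C)) \<le> card D"
      using independent_span_bound[OF D(5)] by blast
    then show False using nv' fB C(5) cBC D(4) card by simp
  qed
  then obtain c where "v = (\<Sum>x\<in>B \<union> C. scale (c x) x)"
    using span_finite[of "B \<union> C"] fB C(5) by auto
  then have "v - (\<Sum>b\<in>B. scale (c b) b) = (\<Sum>x\<in>C. scale (c x) x)"
    using fB C(5) BC(2) by (simp add: sum.union_disjoint)
  also have "\<dots> \<in> U"
    using C(1) U(1) by (intro subspace_sum subspace_scale) auto
  finally show ?thesis using that by blast
qed

text \<open>Correcting each \<open>b\<close> by an element of \<open>Q\<close> keeps the family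
  independent and moves it into \<open>span G\<close>. With \<open>Q\<close> the decomposable
  elements this bounds from below the size of any generating set.\<close>

lemma (in vector_space) indep_mod_card_le:
  assumes B: "indep_mod Q B" and Q: "subspace Q" and G: "finite G"
    and sp: "\<And>b. b \<in> B \<Longrightarrow> \<exists>q\<in>Q. b - q \<in> span G"
  shows "card B \<le> card G"
proof -
  obtain q where q: "\<And>b. b \<in> B \<Longrightarrow> q b \<in> Q" "\<And>b. b \<in> B \<Longrightarrow> b - q b \<in> span G"
    using sp by metis
  have fB: "finite B" using B by (simp add: indep_mod_def)
  have coeff: "c b = 0" if "(\<Sum>b\<in>B. scale (c b) (b - q b)) = 0" "b \<in> B" for c b
  proof -
    have "(\<Sum>b\<in>B. scale (c b) b) = (\<Sum>b\<in>B. scale (c b) (q b))"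
      using that(1) by (simp add: scale_right_diff_distrib sum_subtractf)
    also have "\<dots> \<in> Q" using q Q by (intro subspace_sum subspace_scale) auto
    finally show ?thesis using B that(2) by (simp add: indep_mod_def)
  qed
  have im: "inj_on (\<lambda>b. b - q b) B" "indep_mod {0} ((\<lambda>b. b - q b) ` B)"
    using indep_mod_image[OF fB subspace_single_0, of "\<lambda>b. b - q b"] coeff by auto
  have "independent ((\<lambda>b. b - q b) ` B)"
    using im(2) by (intro independent_if_scalars_zero) (auto simp: indep_mod_def)
  moreover have "(\<lambda>b. b - q b) ` B \<subseteq> span G" using q by auto
  ultimately have "card ((\<lambda>b. b - q b) ` B) \<le> card G"
    using independent_span_bound[OF G] by blast
  then show ?thesis using card_image[OF im(1)] by simp
qed

section \<open>Dimensions of images in a quotient\<close>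

lemma quot_basis_iff_indep_mod:
  fixes V W :: "('k, 'a::field) mpoly set"
  assumes V: "mpoly_vs.subspace V" and W: "mpoly_vs.subspace W"
  shows "quot_basis V W B \<longleftrightarrow> B \<subseteq> V \<and> mpoly_vs.indep_mod (V \<inter> W) B \<and>
    (\<forall>f\<in>V. \<exists>c. f - (\<Sum>b\<in>B. scale (c b) b) \<in> V \<inter> W)"
proof -
  have "(\<Sum>b\<in>B. scale (c b) b) \<in> V" if "B \<subseteq> V" for c :: "_ \<Rightarrow> 'a"
    using that V by (intro mpoly_vs.subspace_sum mpoly_vs.subspace_scale) auto
  then show ?thesis
    unfolding quot_basis_def mpoly_vs.indep_mod_def
    using V by (auto simp: mpoly_vs.subspace_diff)
qed

text \<open>The definite description in \<open>quot_dim\<close> is meaningful only if a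
  \<open>quot_basis\<close> exists and all of them have the same size; both follow by counting
  modulo \<open>V \<inter> W\<close>, which replaces \<open>W\<close> as \<open>W\<close> need not
  lie in \<open>V\<close>.\<close>

lemma quot_dim_eq:
  assumes V: "mpoly_vs.subspace V" "V \<subseteq> mpoly_vs.span F" "finite F" and W: "mpoly_vs.subspace W"
  shows "quot_dim V W + mpoly_vs.dim (V \<inter> W) = mpoly_vs.dim V"
proof -
  note U = mpoly_vs.subspace_inter[OF V(1) W] Int_lower1[of V W]
  obtain B where B: "B \<subseteq> V" "mpoly_vs.indep_mod (V \<inter> W) B"
    "card B + mpoly_vs.dim (V \<inter> W) = mpoly_vs.dim V"
    using mpoly_vs.indep_mod_exists[OF U V(2,3)] by blast
  have "\<exists>c. f - (\<Sum>b\<in>B. scale (c b) b) \<in> V \<inter> W" if "f \<in> V" for f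
    using mpoly_vs.indep_mod_spanning[OF U V(2,3) B(2,1) _ that] B(3) by auto
  with B(1,2) have "quot_basis V W B"
    unfolding quot_basis_iff_indep_mod[OF V(1) W] by blast
  moreover have "card B' = card B" if "quot_basis V W B'" for B'
  proof -
    have "card B' + mpoly_vs.dim (V \<inter> W) = mpoly_vs.dim V"
      using that unfolding quot_basis_iff_indep_mod[OF V(1) W]
      by (intro mpoly_vs.indep_mod_card_spanning[OF U V(2,3)]) auto
    with B(3) show ?thesis by simp
  qed
  ultimately have "quot_dim V W = card B"
    unfolding quot_dim_def by (intro the_equality) blast+
  with B show ?thesis by simp
qed

subsection \<open>Multigraded polynomials\<close>

text \<open>The last case ranges only over terms that occur in \<open>f\<close>, so facts about the
  support of \<open>f\<close>, such as its degree, are available there.\<close>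

lemma poly_mapping_sum_induct [case_names zero add single]:
  fixes f :: "'b \<Rightarrow>\<^sub>0 'c::comm_monoid_add"
  assumes "P 0" and "\<And>f g. P f \<Longrightarrow> P g \<Longrightarrow> P (f + g)"
    and "\<And>t. t \<in> Poly_Mapping.keys f \<Longrightarrow> P (Poly_Mapping.single t (Poly_Mapping.lookup f t))"
  shows "P f"
proof -
  have "f = (\<Sum>t\<in>Poly_Mapping.keys f. Poly_Mapping.single t (Poly_Mapping.lookup f t))"
    by (rule poly_mapping_eqI) (auto simp: lookup_sum lookup_single when_def in_keys_iff)
  moreover have "P (\<Sum>t\<in>T. Poly_Mapping.single t (Poly_Mapping.lookup f t))"
    if "T \<subseteq> Poly_Mapping.keys f" for T
    using finite_subset[OF that finite_keys] that by (induction T rule: finite_induct) (auto intro: assms)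
  ultimately show ?thesis by (metis order_refl)
qed

lemma mdeg_add: "mdeg n (t + u) = mdeg n t + mdeg n u"
  by (simp add: mdeg_def lookup_add sum.distrib fun_eq_iff)

lemma mdeg_single: "m \<le> n l \<Longrightarrow> mdeg n (Poly_Mapping.single (l, m) 1) = std_basis l"
  by (auto simp: mdeg_def std_basis_def lookup_single when_def fun_eq_iff)

lemma polyring_zero: "0 \<in> polyring n"
  by (simp add: polyring_def)

lemma polyring_add: "f \<in> polyring n \<Longrightarrow> g \<in> polyring n \<Longrightarrow> f + g \<in> polyring n"
  using keys_add[of f g] by (auto simp: polyring_def)

lemma polyring_mult:
  assumes "f \<in> polyring n" "g \<in> polyring n"
  shows "f * g \<in> polyring n"
  unfolding polyring_def mem_Collect_eq
proof
  fix t assume "t \<in> Poly_Mapping.keys (f * g)"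
  then obtain a b where "t = a + b" "a \<in> Poly_Mapping.keys f" "b \<in> Poly_Mapping.keys g"
    using keys_mult[of f g] by auto
  with assms show "Poly_Mapping.keys t \<subseteq> Vars n"
    using keys_add[of a b] by (force simp: polyring_def)
qed

lemma polyring_single: "Poly_Mapping.keys t \<subseteq> Vars n \<Longrightarrow> Poly_Mapping.single t c \<in> polyring n"
  by (simp add: polyring_def)

lemma polyring_const: "Poly_Mapping.single 0 c \<in> polyring n"
  by (simp add: polyring_def)

lemma scale_mult_left: "scale c f * g = scale c (f * g)"
  by (simp add: scale_def mult.assoc)

lemma scale_mult_right: "f * scale c g = scale c (f * g)"
  by (simp add: scale_def ac_simps)

lemma graded_polyring: "f \<in> graded n i \<Longrightarrow> f \<in> polyring n"
  by (simp add: graded_def)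

lemma subspace_graded:
  fixes n :: "'k \<Rightarrow> nat"
  shows "mpoly_vs.subspace (graded n i :: ('k, 'a::field) mpoly set)"
  unfolding mpoly_vs.subspace_def
proof (intro conjI ballI allI)
  show "0 \<in> graded n i" by (simp add: graded_alt)
  fix f g :: "('k, 'a) mpoly" assume "f \<in> graded n i" "g \<in> graded n i"
  then show "f + g \<in> graded n i" using keys_add[of f g] by (fastforce simp: graded_alt)
next
  fix c and f :: "('k, 'a) mpoly" assume "f \<in> graded n i"
  then show "scale c f \<in> graded n i"
    by (auto simp: graded_alt in_keys_iff lookup_scale)
qed

lemma graded_mult:
  assumes "f \<in> graded n i" "g \<in> graded n j"
  shows "f * g \<in> graded n (i + j)"
proof -
  have "mdeg n t = i + j" if "t \<in> Poly_Mapping.keys (f * g)" for t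
    using that keys_mult[of f g] assms by (fastforce simp: graded_def mdeg_add)
  with assms show ?thesis by (simp add: graded_def polyring_mult)
qed

lemma graded_var: "m \<le> n l \<Longrightarrow> var l m \<in> graded n (std_basis l)"
  by (simp add: var_def graded_alt mdeg_single[simplified]) (simp add: Vars_def)

lemma finite_span_graded:
  fixes n i :: "'k::finite \<Rightarrow> nat"
  obtains F :: "('k, 'a::field) mpoly set" where "finite F" "graded n i \<subseteq> mpoly_vs.span F"
proof -
  define M where "M = {t :: 'k monom. Poly_Mapping.keys t \<subseteq> Vars n \<and> mdeg n t = i}"
  have "f \<in> mpoly_vs.span ((\<lambda>t. Poly_Mapping.single t 1) ` M)"
    if f: "f \<in> graded n i" for f :: "('k, 'a) mpoly"
  proof (induction f rule: poly_mapping_sum_induct)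
    case (single t)
    then have "t \<in> M" using f by (simp add: graded_alt M_def)
    then have "scale (Poly_Mapping.lookup f t) (Poly_Mapping.single t 1)
        \<in> mpoly_vs.span ((\<lambda>t. Poly_Mapping.single t 1) ` M)"
      by (intro mpoly_vs.span_scale mpoly_vs.span_base) simp
    moreover have "scale (Poly_Mapping.lookup f t) (Poly_Mapping.single t 1)
        = Poly_Mapping.single t (Poly_Mapping.lookup f t)"
      by (simp add: scale_def mult_single)
    ultimately show ?case by simp
  qed (simp_all add: mpoly_vs.span_zero mpoly_vs.span_add)
  moreover have "finite M" unfolding M_def by (rule card_monomials)
  ultimately show ?thesis using that by blast
qed

section \<open>Homogeneous components\<close>

definition hom_part :: "('k \<Rightarrow> nat) \<Rightarrow> ('k \<Rightarrow> nat) \<Rightarrow> ('k, 'a::comm_monoid_add) mpoly \<Rightarrow> ('k, 'a) mpoly" where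
  "hom_part n j f = (\<Sum>t\<in>Poly_Mapping.keys f.
     if mdeg n t = j then Poly_Mapping.single t (Poly_Mapping.lookup f t) else 0)"

lemma lookup_hom_part: "Poly_Mapping.lookup (hom_part n j f) t = (Poly_Mapping.lookup f t when mdeg n t = j)"
proof -
  have "Poly_Mapping.lookup (hom_part n j f) t
      = (\<Sum>u\<in>Poly_Mapping.keys f. if u = t then Poly_Mapping.lookup f t when mdeg n t = j else 0)"
    unfolding hom_part_def lookup_sum by (rule sum.cong) (auto simp: lookup_single when_def)
  then show ?thesis by (auto simp: when_def in_keys_iff)
qed

lemma hom_part_zero: "hom_part n j 0 = 0"
  by (simp add: hom_part_def)

lemma hom_part_add: "hom_part n j (f + g) = hom_part n j f + hom_part n j g"
  by (rule poly_mapping_eqI) (simp add: lookup_hom_part lookup_add when_add_distrib)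

lemma hom_part_scale: "hom_part n j (scale c f) = scale c (hom_part n j f)"
  by (rule poly_mapping_eqI) (simp add: lookup_hom_part lookup_scale mult_when)

lemma hom_part_sum: "hom_part n j (sum f A) = (\<Sum>x\<in>A. hom_part n j (f x))"
  by (induction A rule: infinite_finite_induct) (simp_all add: hom_part_zero hom_part_add)

lemma hom_part_single:
  "hom_part n j (Poly_Mapping.single t c) = (if mdeg n t = j then Poly_Mapping.single t c else 0)"
  by (rule poly_mapping_eqI) (auto simp: lookup_hom_part lookup_single when_def)

lemma hom_part_in_graded: "f \<in> polyring n \<Longrightarrow> hom_part n j f \<in> graded n j"
  by (auto simp: graded_alt polyring_def in_keys_iff lookup_hom_part when_def split: if_splits)

lemma hom_part_of_graded: "f \<in> graded n i \<Longrightarrow> hom_part n j f = (if i = j then f else 0)"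
  by (rule poly_mapping_eqI) (auto simp: lookup_hom_part graded_def in_keys_iff when_def)

lemma sum_hom_part: "(\<Sum>j\<in>mdeg n ` Poly_Mapping.keys f. hom_part n j f) = f"
  by (rule poly_mapping_eqI) (auto simp: lookup_sum lookup_hom_part when_def in_keys_iff)

text \<open>Both sides are additive in \<open>f\<close> and in \<open>g\<close>, so two inductions
  over terms reduce the claim to a product of monomials.\<close>

lemma hom_part_mult:
  fixes f g :: "('k, 'a::comm_ring_1) mpoly"
  assumes "g \<in> graded n i"
  shows "hom_part n j (f * g) = (if i \<le> j then hom_part n (j - i) f * g else 0)"
proof (induction f rule: poly_mapping_sum_induct)
  case zero
  show ?case by (simp add: hom_part_zero)
next
  case (add f1 f2)
  then show ?case unfolding hom_part_add distrib_right by simp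
next
  case (single t)
  let ?s = "Poly_Mapping.single t (Poly_Mapping.lookup f t)"
  show ?case
  proof (induction g rule: poly_mapping_sum_induct)
    case zero
    show ?case by (simp add: hom_part_zero)
  next
    case (add g1 g2)
    then show ?case unfolding hom_part_add distrib_left by simp
  next
    case (single u)
    then have u: "mdeg n u = i" using assms by (simp add: graded_def)
    \<comment> \<open>Subtraction of degrees is truncated, so \<open>j - i\<close> has its meaning
      only together with \<open>i \<le> j\<close>.\<close>
    have "mdeg n t + i = j \<longleftrightarrow> i \<le> j \<and> mdeg n t = j - i"
      by (simp add: fun_eq_iff le_fun_def) (metis add_diff_cancel_right' le_add2 le_add_diff_inverse2)
    then have "mdeg n (t + u) = j \<longleftrightarrow> i \<le> j \<and> mdeg n t = j - i"
      by (simp add: mdeg_add u)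
    then show ?case unfolding mult_single hom_part_single by (auto simp: mult_single)
  qed
qed

lemma monom_factor:
  fixes t :: "'k monom"
  assumes "p \<in> Poly_Mapping.keys t"
  obtains t' where "t = Poly_Mapping.single p 1 + t'" "Poly_Mapping.keys t' \<subseteq> Poly_Mapping.keys t"
proof
  have p: "Poly_Mapping.lookup t p \<noteq> 0" using assms by (simp add: in_keys_iff)
  show "t = Poly_Mapping.single p 1 + (t - Poly_Mapping.single p 1)"
    by (rule poly_mapping_eqI) (use p in \<open>auto simp: lookup_add lookup_minus lookup_single when_def\<close>)
  show "Poly_Mapping.keys (t - Poly_Mapping.single p 1) \<subseteq> Poly_Mapping.keys t"
    by (auto simp: in_keys_iff lookup_minus)
qed

text \<open>A monomial whose degree has a nonzero entry at \<open>l\<close> contains a variable of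
  block \<open>l\<close>, which can be split off.\<close>

lemma graded_span_var_mult:
  fixes f :: "('k, 'a::field) mpoly"
  assumes f: "f \<in> graded n j" and j: "j l \<noteq> 0"
  shows "f \<in> mpoly_vs.span {var l m * g | m g. m \<le> n l \<and> g \<in> graded n (j - std_basis l)}"
    (is "_ \<in> mpoly_vs.span ?S")
proof (induction f rule: poly_mapping_sum_induct)
  case (single t)
  then have t: "Poly_Mapping.keys t \<subseteq> Vars n" "mdeg n t = j" using f by (auto simp: graded_alt)
  have "\<exists>m\<le>n l. (l, m) \<in> Poly_Mapping.keys t"
  proof (rule ccontr)
    assume "\<not> ?thesis"
    then have "mdeg n t l = 0" by (simp add: mdeg_def in_keys_iff)
    with t(2) j show False by simp
  qed
  then obtain m where m: "m \<le> n l" "(l, m) \<in> Poly_Mapping.keys t" by blast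
  from monom_factor[OF m(2)] obtain t' where t': "t = Poly_Mapping.single (l, m) 1 + t'"
    "Poly_Mapping.keys t' \<subseteq> Poly_Mapping.keys t" by blast
  have "mdeg n t' = j - std_basis l"
    using t(2) by (auto simp: t'(1) mdeg_add mdeg_single[of m n l, simplified] m(1))
  then have "Poly_Mapping.single t' (Poly_Mapping.lookup f t) \<in> graded n (j - std_basis l)"
    using t t' by (auto simp: graded_alt)
  moreover have "Poly_Mapping.single t (Poly_Mapping.lookup f t)
      = var l m * Poly_Mapping.single t' (Poly_Mapping.lookup f t)"
    by (simp add: var_def mult_single t'(1))
  ultimately have "Poly_Mapping.single t (Poly_Mapping.lookup f t) \<in> ?S"
    using m(1) by blast
  then show ?case by (rule mpoly_vs.span_base)
qed (simp_all add: mpoly_vs.span_zero mpoly_vs.span_add)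

subsection \<open>Evaluation\<close>

definition eval_monom :: "('k \<Rightarrow> nat \<Rightarrow> 'a::comm_ring_1) \<Rightarrow> 'k monom \<Rightarrow> 'a" where
  "eval_monom v t = (\<Prod>(l, m)\<in>Poly_Mapping.keys t. v l m ^ Poly_Mapping.lookup t (l, m))"

lemma eval_monom_superset:
  assumes "finite S" "Poly_Mapping.keys t \<subseteq> S"
  shows "eval_monom v t = (\<Prod>(l, m)\<in>S. v l m ^ Poly_Mapping.lookup t (l, m))"
  unfolding eval_monom_def
  by (rule prod.mono_neutral_left) (use assms in \<open>auto simp: in_keys_iff\<close>)

lemma eval_monom_add: "eval_monom v (t + u) = eval_monom v t * eval_monom v u"
proof -
  let ?S = "Poly_Mapping.keys t \<union> Poly_Mapping.keys u"
  have "eval_monom v (t + u) = (\<Prod>(l, m)\<in>?S. v l m ^ Poly_Mapping.lookup (t + u) (l, m))"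
    by (rule eval_monom_superset) (simp_all add: keys_add)
  also have "\<dots> = (\<Prod>(l, m)\<in>?S. v l m ^ Poly_Mapping.lookup t (l, m)) *
      (\<Prod>(l, m)\<in>?S. v l m ^ Poly_Mapping.lookup u (l, m))"
    unfolding prod.distrib[symmetric] by (rule prod.cong) (auto simp: lookup_add power_add)
  also have "\<dots> = eval_monom v t * eval_monom v u"
    using eval_monom_superset[of ?S t v] eval_monom_superset[of ?S u v] by simp
  finally show ?thesis .
qed

lemma eval_at_superset:
  assumes "finite S" "Poly_Mapping.keys f \<subseteq> S"
  shows "eval_at v f = (\<Sum>t\<in>S. Poly_Mapping.lookup f t * eval_monom v t)"
  unfolding eval_at_def eval_monom_def[symmetric]
  by (rule sum.mono_neutral_left) (use assms in \<open>auto simp: in_keys_iff\<close>)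

lemma eval_at_single: "eval_at v (Poly_Mapping.single t c) = c * eval_monom v t"
  using eval_at_superset[of "{t}" "Poly_Mapping.single t c" v] by simp

lemma eval_at_zero: "eval_at v 0 = 0"
  by (simp add: eval_at_def)

lemma eval_at_add: "eval_at v (f + g) = eval_at v f + eval_at v g"
proof -
  let ?S = "Poly_Mapping.keys f \<union> Poly_Mapping.keys g"
  have "eval_at v h = (\<Sum>t\<in>?S. Poly_Mapping.lookup h t * eval_monom v t)"
    if "Poly_Mapping.keys h \<subseteq> ?S" for h
    by (rule eval_at_superset) (use that in simp_all)
  from this[of f] this[of g] this[of "f + g"] show ?thesis
    by (simp add: keys_add lookup_add distrib_right sum.distrib)
qed

lemma eval_at_sum: "eval_at v (sum f A) = (\<Sum>x\<in>A. eval_at v (f x))"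
  by (induction A rule: infinite_finite_induct) (simp_all add: eval_at_zero eval_at_add)

lemma eval_at_mult: "eval_at v (f * g) = eval_at v f * eval_at v g"
proof (induction f rule: poly_mapping_sum_induct)
  case zero
  show ?case by (simp add: eval_at_zero)
next
  case (add f1 f2)
  then show ?case by (simp add: eval_at_add distrib_right)
next
  case (single t)
  show ?case
  proof (induction g rule: poly_mapping_sum_induct)
    case (single u)
    show ?case by (simp add: eval_at_single mult_single eval_monom_add ac_simps)
  qed (simp_all add: eval_at_zero eval_at_add distrib_left)
qed

lemma eval_at_scale: "eval_at v (scale c f) = c * eval_at v f"
  by (simp add: scale_def eval_at_mult eval_at_single) (simp add: eval_monom_def)

lemma eval_at_var: "eval_at v (var l m) = v l m"
  by (simp add: var_def eval_at_single eval_monom_def)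

subsection \<open>Generated ideals\<close>

lemma ideal_generated_base: "g \<in> G \<Longrightarrow> g \<in> ideal_generated n G"
  unfolding ideal_generated_def mem_Collect_eq
  by (rule exI[of _ "{g}"], rule exI[of _ "\<lambda>_. 1"]) (auto simp: polyring_def)

lemma ideal_generated_zero: "0 \<in> ideal_generated n G"
  unfolding ideal_generated_def mem_Collect_eq by (rule exI[of _ "{}"]) auto

lemma ideal_generated_add:
  assumes "f \<in> ideal_generated n G" "g \<in> ideal_generated n G"
  shows "f + g \<in> ideal_generated n G"
proof -
  obtain F c where F: "finite F" "F \<subseteq> G" "\<forall>g\<in>F. c g \<in> polyring n" "f = (\<Sum>g\<in>F. c g * g)"
    using assms(1) by (auto simp: ideal_generated_def)
  obtain F' c' where F': "finite F'" "F' \<subseteq> G" "\<forall>g\<in>F'. c' g \<in> polyring n" "g = (\<Sum>g\<in>F'. c' g * g)"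
    using assms(2) by (auto simp: ideal_generated_def)
  \<comment> \<open>Both combinations are extended by zero to \<open>F \<union> F'\<close>; on the
    overlap the coefficients add.\<close>
  define d where "d = (\<lambda>g. (if g \<in> F then c g else 0) + (if g \<in> F' then c' g else 0))"
  have "f = (\<Sum>g\<in>F \<union> F'. (if g \<in> F then c g else 0) * g)"
    unfolding F(4) by (rule sum.mono_neutral_cong_left) (use F F' in auto)
  moreover have "g = (\<Sum>g\<in>F \<union> F'. (if g \<in> F' then c' g else 0) * g)"
    unfolding F'(4) by (rule sum.mono_neutral_cong_left) (use F F' in auto)
  ultimately have "f + g = (\<Sum>g\<in>F \<union> F'. d g * g)"
    by (simp add: d_def distrib_right sum.distrib)
  moreover have "\<forall>g\<in>F \<union> F'. d g \<in> polyring n"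
    using F F' by (auto simp: d_def polyring_add)
  ultimately show ?thesis
    unfolding ideal_generated_def mem_Collect_eq using F F'
    by (intro exI[of _ "F \<union> F'"] exI[of _ d]) auto
qed

lemma ideal_generated_mult:
  assumes "p \<in> polyring n" "f \<in> ideal_generated n G"
  shows "p * f \<in> ideal_generated n G"
proof -
  obtain F c where F: "finite F" "F \<subseteq> G" "\<forall>g\<in>F. c g \<in> polyring n" "f = (\<Sum>g\<in>F. c g * g)"
    using assms(2) by (auto simp: ideal_generated_def)
  have "p * f = (\<Sum>g\<in>F. (p * c g) * g)"
    by (simp add: F(4) sum_distrib_left mult.assoc)
  then show ?thesis
    unfolding ideal_generated_def mem_Collect_eq using F assms(1)
    by (intro exI[of _ F] exI[of _ "\<lambda>g. p * c g"]) (auto simp: polyring_mult)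
qed

lemma subspace_ideal_generated: "mpoly_vs.subspace (ideal_generated n G)"
  unfolding mpoly_vs.subspace_def scale_def
  by (simp add: ideal_generated_zero ideal_generated_add ideal_generated_mult polyring_const)

lemma ideal_generated_minimal:
  assumes "0 \<in> J" "\<And>f g. f \<in> J \<Longrightarrow> g \<in> J \<Longrightarrow> f + g \<in> J"
    and "\<And>p f. p \<in> polyring n \<Longrightarrow> f \<in> G \<Longrightarrow> p * f \<in> J"
  shows "ideal_generated n G \<subseteq> J"
proof
  fix f assume "f \<in> ideal_generated n G"
  then obtain F c where F: "finite F" "F \<subseteq> G" "\<forall>g\<in>F. c g \<in> polyring n" "f = (\<Sum>g\<in>F. c g * g)"
    by (auto simp: ideal_generated_def)
  show "f \<in> J" unfolding F(4) using F(1-3)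
    by (induction F rule: finite_induct) (auto intro: assms)
qed

subsection \<open>The ideal of a set of points\<close>

lemma vanishes_at_zero: "vanishes_at 0 P"
  by (simp add: vanishes_at_def eval_at_zero)

lemma vanishes_at_add: "vanishes_at f P \<Longrightarrow> vanishes_at g P \<Longrightarrow> vanishes_at (f + g) P"
  by (simp add: vanishes_at_def eval_at_add)

lemma vanishes_at_mult: "vanishes_at f P \<Longrightarrow> vanishes_at (p * f) P"
  by (simp add: vanishes_at_def eval_at_mult)

lemma point_ideal_vanishes:
  assumes "f \<in> point_ideal n X"
  shows "f \<in> polyring n" "P \<in> X \<Longrightarrow> vanishes_at f P"
proof -
  have "point_ideal n X \<subseteq> {f \<in> polyring n. \<forall>P\<in>X. vanishes_at f P}"
    unfolding point_ideal_def
    by (rule ideal_generated_minimal)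
      (auto simp: polyring_zero polyring_add polyring_mult vanishes_at_zero vanishes_at_add
        vanishes_at_mult dest: graded_polyring)
  with assms show "f \<in> polyring n" "P \<in> X \<Longrightarrow> vanishes_at f P" by auto
qed

text \<open>All elements of the ideal vanish on \<open>X\<close>, and a form vanishing on
  \<open>X\<close> is one of the generators. Membership in a graded piece thus becomes a pointwise
  condition.\<close>

lemma point_ideal_part_eq:
  "point_ideal_part n X i = {f \<in> graded n i. \<forall>P\<in>X. vanishes_at f P}"
proof (intro equalityI subsetI)
  fix f assume "f \<in> point_ideal_part n X i"
  then show "f \<in> {f \<in> graded n i. \<forall>P\<in>X. vanishes_at f P}"
    by (auto simp: point_ideal_part_def point_ideal_vanishes)
next
  fix f assume "f \<in> {f \<in> graded n i. \<forall>P\<in>X. vanishes_at f P}"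
  then show "f \<in> point_ideal_part n X i"
    by (auto simp: point_ideal_part_def point_ideal_def intro!: ideal_generated_base)
qed

lemma point_ideal_part_subset: "point_ideal_part n X i \<subseteq> point_ideal n X"
  by (simp add: point_ideal_part_def)

lemma point_ideal_part_graded: "f \<in> point_ideal_part n X i \<Longrightarrow> f \<in> graded n i"
  by (simp add: point_ideal_part_def)

lemma subspace_point_ideal: "mpoly_vs.subspace (point_ideal n X)"
  unfolding point_ideal_def by (rule subspace_ideal_generated)

lemma subspace_point_ideal_part: "mpoly_vs.subspace (point_ideal_part n X i)"
  unfolding point_ideal_part_def
  by (intro mpoly_vs.subspace_inter subspace_point_ideal subspace_graded)

lemma point_ideal_mult: "p \<in> polyring n \<Longrightarrow> f \<in> point_ideal n X \<Longrightarrow> p * f \<in> point_ideal n X"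
  unfolding point_ideal_def by (rule ideal_generated_mult)

lemma point_ideal_part_mult:
  "p \<in> graded n i \<Longrightarrow> f \<in> point_ideal_part n X j \<Longrightarrow> p * f \<in> point_ideal_part n X (i + j)"
  by (simp add: point_ideal_part_eq graded_mult vanishes_at_mult)

text \<open>The ideal is homogeneous: a component of \<open>p * g\<close> with \<open>g\<close> a
  form of the ideal is a component of \<open>p\<close> times \<open>g\<close>, or zero.\<close>

lemma hom_part_point_ideal:
  assumes "f \<in> point_ideal n X"
  shows "hom_part n j f \<in> point_ideal_part n X j"
proof -
  have "hom_part n j (p * g) \<in> point_ideal_part n X j"
    if p: "p \<in> polyring n" and g: "g \<in> point_ideal_part n X i" for p g i
  proof (cases "i \<le> j")
    case True
    then have "j - i + i = j" by (auto simp: fun_eq_iff le_fun_def)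
    with point_ideal_part_mult[OF hom_part_in_graded[OF p] g, of "j - i"] True show ?thesis
      unfolding hom_part_mult[OF point_ideal_part_graded[OF g]] by simp
  next
    case False
    then show ?thesis
      unfolding hom_part_mult[OF point_ideal_part_graded[OF g]]
      by (simp add: mpoly_vs.subspace_0 subspace_point_ideal_part)
  qed
  moreover have "0 \<in> point_ideal_part n X j"
    "\<And>f g. f \<in> point_ideal_part n X j \<Longrightarrow> g \<in> point_ideal_part n X j \<Longrightarrow>
      f + g \<in> point_ideal_part n X j"
    by (rule mpoly_vs.subspace_0[OF subspace_point_ideal_part],
        rule mpoly_vs.subspace_add[OF subspace_point_ideal_part])
  ultimately have "point_ideal n X \<subseteq> {f. hom_part n j f \<in> point_ideal_part n X j}"
    unfolding point_ideal_def
    by (intro ideal_generated_minimal) (simp_all add: hom_part_zero hom_part_add, auto simp: point_ideal_part_eq)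
  with assms show ?thesis by auto
qed

lemma point_ideal_subset_of_parts:
  assumes "mpoly_vs.subspace S" "\<And>j. point_ideal_part n X j \<subseteq> S"
  shows "point_ideal n X \<subseteq> S"
proof
  fix f assume f: "f \<in> point_ideal n X"
  have "(\<Sum>j\<in>mdeg n ` Poly_Mapping.keys f. hom_part n j f) \<in> S"
    using hom_part_point_ideal[OF f] assms by (intro mpoly_vs.subspace_sum) auto
  then show "f \<in> S" by (simp only: sum_hom_part)
qed

subsection \<open>Decomposable elements of the ideal\<close>

text \<open>
  With \<open>R\<^sub>+\<close> the ideal of the variables, \<open>decomp n X\<close> is \<open>R\<^sub>+ I\<close> and
  \<open>decomp_part n X j\<close> its piece of degree \<open>j\<close>.
\<close>

definition decomp :: "('k \<Rightarrow> nat) \<Rightarrow> ('k \<Rightarrow> (nat \<Rightarrow> 'a::field) set) set \<Rightarrow> ('k, 'a) mpoly set" where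
  "decomp n X = mpoly_vs.span {var l m * f | l m f. m \<le> n l \<and> f \<in> point_ideal n X}"

definition decomp_part ::
  "('k \<Rightarrow> nat) \<Rightarrow> ('k \<Rightarrow> (nat \<Rightarrow> 'a::field) set) set \<Rightarrow> ('k \<Rightarrow> nat) \<Rightarrow> ('k, 'a) mpoly set" where
  "decomp_part n X j = mpoly_vs.span
     {var l m * f | l m f. m \<le> n l \<and> j l \<noteq> 0 \<and> f \<in> point_ideal_part n X (j - std_basis l)}"

lemma std_basis_le_iff: "std_basis l \<le> j \<longleftrightarrow> j l \<noteq> 0"
  by (auto simp: le_fun_def std_basis_def)

lemma std_basis_add_diff: "j l \<noteq> 0 \<Longrightarrow> std_basis l + (j - std_basis l) = j"
  by (auto simp: fun_eq_iff std_basis_def)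

lemma subspace_decomp: "mpoly_vs.subspace (decomp n X)"
  by (simp add: decomp_def)

lemma subspace_decomp_part: "mpoly_vs.subspace (decomp_part n X j)"
  by (simp add: decomp_part_def)

lemma decomp_part_base:
  "m \<le> n l \<Longrightarrow> f \<in> point_ideal_part n X (j - std_basis l) \<Longrightarrow> j l \<noteq> 0 \<Longrightarrow>
    var l m * f \<in> decomp_part n X j"
  unfolding decomp_part_def by (rule mpoly_vs.span_base) blast

lemma decomp_part_subset: "decomp_part n X j \<subseteq> point_ideal_part n X j"
  unfolding decomp_part_def
proof (rule mpoly_vs.span_minimal[OF _ subspace_point_ideal_part], safe)
  fix l m f assume "m \<le> n l" "0 < j l" "f \<in> point_ideal_part n X (j - std_basis l)"
  then show "var l m * f \<in> point_ideal_part n X j"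
    using point_ideal_part_mult[OF graded_var, of m n l f X "j - std_basis l"]
    by (simp add: std_basis_add_diff)
qed

text \<open>The factor from the ideal in a spanning element of \<open>decomp n X\<close> need not be
  homogeneous; its components stay in the ideal, and taking components lowers the degree by that of
  the variable.\<close>

lemma hom_part_decomp:
  assumes "f \<in> decomp n X"
  shows "hom_part n j f \<in> decomp_part n X j"
  using assms unfolding decomp_def
proof (induction rule: mpoly_vs.span_induct)
  case base
  show ?case
    by (auto simp: mpoly_vs.subspace_def hom_part_zero hom_part_add hom_part_scale
        subspace_decomp_part[unfolded mpoly_vs.subspace_def])
next
  case (step x)
  then obtain l m g where x: "x = g * var l m" "m \<le> n l" "g \<in> point_ideal n X"
    by (auto simp: mult.commute)
  show ?case
  proof (cases "j l = 0")
    case True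
    then show ?thesis
      using hom_part_mult[OF graded_var[of m n l], of j g] x
      by (simp add: std_basis_le_iff mpoly_vs.subspace_0 subspace_decomp_part)
  next
    case False
    then have "hom_part n j x = var l m * hom_part n (j - std_basis l) g"
      using hom_part_mult[OF graded_var[of m n l], of j g] x by (simp add: std_basis_le_iff mult.commute)
    moreover have "var l m * hom_part n (j - std_basis l) g \<in> decomp_part n X j"
      using x False by (intro decomp_part_base hom_part_point_ideal)
    ultimately show ?thesis by simp
  qed
qed

text \<open>Modulo decomposable elements only the constant term of a coefficient matters: from any
  other monomial a variable splits off, and the remaining factor keeps \<open>f\<close> in the
  ideal.\<close>

lemma mult_minus_const_decomp:
  assumes p: "p \<in> polyring n" and f: "f \<in> point_ideal n X"
  shows "p * f - scale (Poly_Mapping.lookup p 0) f \<in> decomp n X"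
proof (induction p rule: poly_mapping_sum_induct)
  case zero
  show ?case by (simp add: mpoly_vs.subspace_0 subspace_decomp)
next
  case (add p q)
  have "(p + q) * f - scale (Poly_Mapping.lookup (p + q) 0) f =
      (p * f - scale (Poly_Mapping.lookup p 0) f) + (q * f - scale (Poly_Mapping.lookup q 0) f)"
    by (simp add: distrib_right lookup_add mpoly_vs.scale_left_distrib)
  with add show ?case by (simp only: mpoly_vs.subspace_add subspace_decomp)
next
  case (single t)
  then have t: "Poly_Mapping.keys t \<subseteq> Vars n" using p by (simp add: polyring_def)
  show ?case
  proof (cases "t = 0")
    case True
    then show ?thesis by (simp add: scale_def mpoly_vs.subspace_0 subspace_decomp)
  next
    case False
    then obtain l m where lm: "(l, m) \<in> Poly_Mapping.keys t"
      by (metis ex_in_conv keys_eq_empty surj_pair)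
    from monom_factor[OF lm] obtain t' where t': "t = Poly_Mapping.single (l, m) 1 + t'"
      "Poly_Mapping.keys t' \<subseteq> Poly_Mapping.keys t" by blast
    let ?c = "Poly_Mapping.lookup p t"
    have "Poly_Mapping.single t' ?c * f \<in> point_ideal n X"
      using t t' f by (intro point_ideal_mult polyring_single) auto
    moreover have "m \<le> n l" using lm t by (auto simp: Vars_def)
    moreover have "Poly_Mapping.single t ?c * f = var l m * (Poly_Mapping.single t' ?c * f)"
      by (simp add: var_def mult_single t'(1) mult.assoc[symmetric])
    ultimately have "Poly_Mapping.single t ?c * f \<in> decomp n X"
      unfolding decomp_def by (intro mpoly_vs.span_base) blast
    then show ?thesis using False by (simp add: lookup_single scale_def)
  qed
qed

lemma finite_span_point_ideal_part:
  fixes n i :: "'k::finite \<Rightarrow> nat" and X :: "('k \<Rightarrow> (nat \<Rightarrow> 'a::field) set) set"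
  obtains F where "finite F" "point_ideal_part n X i \<subseteq> mpoly_vs.span F"
proof -
  obtain F :: "('k, 'a) mpoly set" where "finite F" "graded n i \<subseteq> mpoly_vs.span F"
    by (rule finite_span_graded)
  with that show ?thesis by (auto simp: point_ideal_part_def)
qed

text \<open>Graded Nakayama: lifts of bases of all quotients I_j / (R_+ I)_j form a generating set
  \<open>G\<close>. Any finite generating set, homogeneous or not, spans \<open>G\<close> over the
  field modulo R_+ I, so it has at least as many elements.\<close>

theorem min_gens_point_ideal:
  fixes n :: "'k::finite \<Rightarrow> nat" and X :: "('k \<Rightarrow> (nat \<Rightarrow> 'a::field) set) set"
  assumes J: "finite J" and rest: "\<And>j. j \<notin> J \<Longrightarrow> point_ideal_part n X j = decomp_part n X j"
  shows "int (min_gens n (point_ideal n X)) =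
    (\<Sum>j\<in>J. int (mpoly_vs.dim (point_ideal_part n X j)) - int (mpoly_vs.dim (decomp_part n X j)))"
proof -
  let ?I = "point_ideal n X"
  have "\<exists>B. B \<subseteq> point_ideal_part n X j \<and> mpoly_vs.indep_mod (decomp_part n X j) B \<and>
      card B + mpoly_vs.dim (decomp_part n X j) = mpoly_vs.dim (point_ideal_part n X j)" for j
  proof -
    obtain F where F: "finite F" "point_ideal_part n X j \<subseteq> mpoly_vs.span F"
      by (rule finite_span_point_ideal_part)
    from mpoly_vs.indep_mod_exists[OF subspace_decomp_part decomp_part_subset F(2,1)]
    show ?thesis by blast
  qed
  then obtain B where B: "\<And>j. B j \<subseteq> point_ideal_part n X j"
    "\<And>j. mpoly_vs.indep_mod (decomp_part n X j) (B j)"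
    "\<And>j. card (B j) + mpoly_vs.dim (decomp_part n X j) = mpoly_vs.dim (point_ideal_part n X j)"
    by metis
  define G where "G = (\<Union>j\<in>J. B j)"
  have finB: "finite (B j)" for j using B(2) by (simp add: mpoly_vs.indep_mod_def)
  have hom_part_B: "hom_part n j b = (if i = j then b else 0)" if "b \<in> B i" for i j b
    using that B(1) by (intro hom_part_of_graded point_ideal_part_graded) auto
  \<comment> \<open>A common element would be its own component of degree \<open>j\<close> and also
    have that component zero; but 0 belongs to no set independent modulo a subspace.\<close>
  have disj: "B i \<inter> B j = {}" if "i \<noteq> j" for i j
  proof (rule ccontr)
    assume "B i \<inter> B j \<noteq> {}"
    then obtain b where b: "b \<in> B i" "b \<in> B j" by auto
    then have "b = 0" using hom_part_B[of b i j] hom_part_B[of b j j] that by simp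
    with b mpoly_vs.indep_mod_zero_notin[OF B(2) subspace_decomp_part] show False by blast
  qed
  have finG: "finite G" using J finB by (simp add: G_def)
  have GI: "G \<subseteq> ?I" using B(1) point_ideal_part_subset by (fastforce simp: G_def)
  have cardG: "int (card G) = (\<Sum>j\<in>J. int (mpoly_vs.dim (point_ideal_part n X j)) -
      int (mpoly_vs.dim (decomp_part n X j)))"
  proof -
    have "card G = (\<Sum>j\<in>J. card (B j))"
      unfolding G_def by (rule card_UN_disjoint) (use J finB disj in auto)
    moreover have "int (card (B j)) = int (mpoly_vs.dim (point_ideal_part n X j)) -
        int (mpoly_vs.dim (decomp_part n X j))" for j
      using B(3)[of j] by linarith
    ultimately show ?thesis by simp
  qed
  \<comment> \<open>Induction on the total degree: decomposable elements come from lower degrees,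
    and modulo them the piece is spanned by \<open>B j\<close>, or is zero if
    \<open>j \<notin> J\<close>.\<close>
  have part: "point_ideal_part n X j \<subseteq> ideal_generated n G" for j
  proof (induction "\<Sum>l\<in>UNIV. j l" arbitrary: j rule: less_induct)
    case less
    have D: "decomp_part n X j \<subseteq> ideal_generated n G"
      unfolding decomp_part_def
    proof (rule mpoly_vs.span_minimal[OF _ subspace_ideal_generated], safe)
      fix l m f assume *: "m \<le> n l" "0 < j l" "f \<in> point_ideal_part n X (j - std_basis l)"
      have "(\<Sum>k\<in>UNIV. (j - std_basis l) k) < (\<Sum>k\<in>UNIV. j k)"
      proof (rule sum_strict_mono_ex1)
        show "\<exists>a\<in>UNIV. (j - std_basis l) a < j a"
          using *(2) by (intro bexI[of _ l]) (auto simp: std_basis_def)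
      qed auto
      from less[OF this] * have "f \<in> ideal_generated n G" by blast
      then show "var l m * f \<in> ideal_generated n G"
        using *(1) by (intro ideal_generated_mult graded_polyring[OF graded_var])
    qed
    show ?case
    proof (cases "j \<in> J")
      case False
      with rest D show ?thesis by simp
    next
      case True
      show ?thesis
      proof
        fix f assume f: "f \<in> point_ideal_part n X j"
        obtain F where F: "finite F" "point_ideal_part n X j \<subseteq> mpoly_vs.span F"
          by (rule finite_span_point_ideal_part)
        obtain c where c: "f - (\<Sum>b\<in>B j. scale (c b) b) \<in> decomp_part n X j"
          using mpoly_vs.indep_mod_spanning[OF subspace_decomp_part decomp_part_subset F(2,1)
              B(2) B(1) _ f] B(3)[of j] by auto
        have "(\<Sum>b\<in>B j. scale (c b) b) \<in> ideal_generated n G"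
          using True by (intro mpoly_vs.subspace_sum mpoly_vs.subspace_scale
              subspace_ideal_generated ideal_generated_base) (auto simp: G_def)
        from ideal_generated_add[OF this subsetD[OF D c]] show "f \<in> ideal_generated n G" by simp
      qed
    qed
  qed
  have "ideal_generated n G = ?I"
  proof
    show "?I \<subseteq> ideal_generated n G"
      by (rule point_ideal_subset_of_parts[OF subspace_ideal_generated part])
    show "ideal_generated n G \<subseteq> ?I"
      using GI mpoly_vs.subspace_0[OF subspace_point_ideal]
        mpoly_vs.subspace_add[OF subspace_point_ideal] point_ideal_mult
      by (intro ideal_generated_minimal) blast+
  qed
  moreover have "G \<subseteq> polyring n" using GI point_ideal_vanishes(1) by blast
  moreover have "card G \<le> card G'"
    if G': "finite G'" "ideal_generated n G' = ?I" for G'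
  proof (rule mpoly_vs.indep_mod_card_le[OF _ subspace_decomp G'(1)])
    show "mpoly_vs.indep_mod (decomp n X) G"
      unfolding mpoly_vs.indep_mod_def
    proof (intro conjI allI impI ballI)
      fix c b assume s: "(\<Sum>b\<in>G. scale (c b) b) \<in> decomp n X" and b: "b \<in> G"
      then obtain j where j: "j \<in> J" "b \<in> B j" by (auto simp: G_def)
      \<comment> \<open>The component of degree \<open>j\<close> of a relation involves
        \<open>B j\<close> only, so independence modulo R_+ I can be checked degree by
        degree.\<close>
      have "hom_part n j (\<Sum>b\<in>G. scale (c b) b) = (\<Sum>b\<in>G. scale (c b) (hom_part n j b))"
        by (simp add: hom_part_sum hom_part_scale)
      also have "\<dots> = (\<Sum>b\<in>B j. scale (c b) b)"
      proof (rule sum.mono_neutral_cong_right[OF finG])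
        show "\<forall>b\<in>G - B j. scale (c b) (hom_part n j b) = 0"
          by (auto simp: G_def hom_part_B split: if_splits)
      qed (use j hom_part_B in \<open>auto simp: G_def\<close>)
      finally have "(\<Sum>b\<in>B j. scale (c b) b) \<in> decomp_part n X j"
        using hom_part_decomp[OF s, of j] by simp
      with B(2)[of j] j(2) show "c b = 0" by (simp add: mpoly_vs.indep_mod_def)
    qed (rule finG)
    fix b assume "b \<in> G"
    then have "b \<in> ideal_generated n G'" using GI G'(2) by blast
    then obtain F c where F: "finite F" "F \<subseteq> G'" "\<forall>g\<in>F. c g \<in> polyring n" "b = (\<Sum>g\<in>F. c g * g)"
      by (auto simp: ideal_generated_def)
    \<comment> \<open>\<open>q\<close> is the error made on replacing every coefficient by its
      constant term.\<close>
    define q where "q = (\<Sum>g\<in>F. c g * g - scale (Poly_Mapping.lookup (c g) 0) g)"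
    have "g \<in> ?I" if "g \<in> F" for g
      using that F(2) G'(2) ideal_generated_base by blast
    then have "q \<in> decomp n X"
      unfolding q_def using F(3)
      by (intro mpoly_vs.subspace_sum subspace_decomp mult_minus_const_decomp) auto
    moreover have "b - q = (\<Sum>g\<in>F. scale (Poly_Mapping.lookup (c g) 0) g)"
      by (simp add: F(4) q_def sum_subtractf)
    moreover have "\<dots> \<in> mpoly_vs.span G'"
      using F(2) by (intro mpoly_vs.span_sum mpoly_vs.span_scale mpoly_vs.span_base) auto
    ultimately show "\<exists>q\<in>decomp n X. b - q \<in> mpoly_vs.span G'"
      by (intro bexI[of _ q]) simp_all
  qed
  ultimately have "min_gens n ?I = card G"
    unfolding min_gens_def using finG by (intro Least_equality) blast+
  with cardG show ?thesis by simp
qed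

subsection \<open>Points in generic position\<close>

lemma hilbert_fun_add_dim:
  fixes n i :: "'k::finite \<Rightarrow> nat" and X :: "('k \<Rightarrow> (nat \<Rightarrow> 'a::field) set) set"
  shows "hilbert_fun n X i + mpoly_vs.dim (point_ideal_part n X i) = NN n i"
proof -
  obtain F :: "('k, 'a) mpoly set" where "finite F" "graded n i \<subseteq> mpoly_vs.span F"
    by (rule finite_span_graded)
  from quot_dim_eq[OF subspace_graded this(2,1) subspace_point_ideal[of n X]] show ?thesis
    by (simp add: hilbert_fun_def point_ideal_part_def dim_graded Int_commute)
qed

lemma generic_position_dim:
  assumes "generic_position n X"
  shows "min (NN n i) (card X) + mpoly_vs.dim (point_ideal_part n X i) = NN n i"
  using assms hilbert_fun_add_dim[of n X i] by (simp add: generic_position_def)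

lemma generic_position_part_zero:
  assumes "generic_position n X" "NN n i \<le> card X"
  shows "point_ideal_part n X i = {0}"
proof -
  obtain F where F: "finite F" "point_ideal_part n X i \<subseteq> mpoly_vs.span F"
    by (rule finite_span_point_ideal_part)
  obtain C where C: "point_ideal_part n X i \<subseteq> mpoly_vs.span C"
    "card C = mpoly_vs.dim (point_ideal_part n X i)" "finite C"
    using mpoly_vs.finite_basis_exists[OF F(2,1)] by metis
  \<comment> \<open>Finiteness of \<open>C\<close> matters here, since \<open>card\<close> is 0 for
    infinite sets too.\<close>
  have "C = {}" using C(2,3) generic_position_dim[OF assms(1), of i] assms(2) by simp
  with C(1) show ?thesis using mpoly_vs.subspace_0[OF subspace_point_ideal_part] by auto
qed

text \<open>Look for coefficients on the moment curve, \<open>a m = t ^ m\<close>. The value at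
  \<open>v\<close> is then a nonzero polynomial in \<open>t\<close>; finitely many such polynomials
  have finitely many roots, and the field is infinite.\<close>

lemma exists_linear_functional_nonzero:
  fixes A :: "(nat \<Rightarrow> 'a::field_char_0) set"
  assumes "finite A" "A \<subseteq> punctured d"
  obtains a where "\<And>v. v \<in> A \<Longrightarrow> (\<Sum>m\<le>d. a m * v m) \<noteq> 0"
proof -
  define p where "p v = (\<Sum>m\<le>d. monom (v m) m)" for v :: "nat \<Rightarrow> 'a"
  have "p v \<noteq> 0" if "v \<in> A" for v
  proof -
    have "v \<in> punctured d" using assms(2) that by blast
    then obtain m where m: "m \<le> d" "v m \<noteq> 0" by (auto simp: punctured_def)
    then have "coeff (p v) m = v m" by (simp add: p_def coeff_sum)
    with m show ?thesis by auto
  qed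
  then have "finite (\<Union>v\<in>A. {x. poly (p v) x = 0})"
    using assms(1) by (simp add: poly_roots_finite)
  then obtain t where "t \<notin> (\<Union>v\<in>A. {x. poly (p v) x = 0})"
    using ex_new_if_finite[OF infinite_UNIV_char_0] by blast
  then have "(\<Sum>m\<le>d. t ^ m * v m) \<noteq> 0" if "v \<in> A" for v
    using that by (simp add: p_def poly_sum poly_monom mult.commute)
  with that show ?thesis by blast
qed

section \<open>Linear forms that vanish at no point of the set\<close>

definition linear_form :: "('k \<Rightarrow> nat) \<Rightarrow> 'k \<Rightarrow> (nat \<Rightarrow> 'a::field) \<Rightarrow> ('k, 'a) mpoly" where
  "linear_form n l a = (\<Sum>m\<le>n l. scale (a m) (var l m))"

lemma linear_form_graded: "linear_form n l a \<in> graded n (std_basis l)"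
  unfolding linear_form_def
  by (intro mpoly_vs.subspace_sum mpoly_vs.subspace_scale subspace_graded graded_var) simp

lemma linear_form_mult_decomp_part:
  assumes "f \<in> point_ideal_part n X (j - std_basis l)" "j l \<noteq> 0"
  shows "linear_form n l a * f \<in> decomp_part n X j"
  unfolding linear_form_def sum_distrib_right scale_mult_left
  using assms
  by (intro mpoly_vs.subspace_sum mpoly_vs.subspace_scale subspace_decomp_part decomp_part_base) auto

text \<open>Nonvanishing is demanded at every representative of a point, so that the value of
  \<open>h\<close> can be cancelled pointwise.\<close>

definition avoids :: "('k, 'a::field) mpoly \<Rightarrow> ('k \<Rightarrow> (nat \<Rightarrow> 'a) set) set \<Rightarrow> bool" where
  "avoids h X \<longleftrightarrow> (\<forall>P\<in>X. \<forall>v. (\<forall>l. v l \<in> P l) \<longrightarrow> eval_at v h \<noteq> 0)"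

text \<open>One representative of the coordinate \<open>l\<close> per point is enough: any other
  differs by a nonzero factor, which only rescales the value of the form.\<close>

lemma exists_linear_form_avoids:
  fixes X :: "('k \<Rightarrow> (nat \<Rightarrow> 'a::field_char_0) set) set"
  assumes "finite X" "X \<subseteq> multiproj n"
  obtains a where "avoids (linear_form n l a) X"
proof -
  have "\<exists>w. w \<in> punctured (n l) \<and> P l = proportional (n l) `` {w}" if "P \<in> X" for P
    using that assms(2) by (fastforce simp: multiproj_def proj_space_def elim: quotientE)
  then obtain w where w: "\<And>P. P \<in> X \<Longrightarrow> w P \<in> punctured (n l)"
    "\<And>P. P \<in> X \<Longrightarrow> P l = proportional (n l) `` {w P}" by metis
  obtain a where a: "\<And>v. v \<in> w ` X \<Longrightarrow> (\<Sum>m\<le>n l. a m * v m) \<noteq> 0"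
    using exists_linear_functional_nonzero[of "w ` X" "n l"] assms(1) w(1) by blast
  have "avoids (linear_form n l a) X"
    unfolding avoids_def
  proof (intro ballI allI impI)
    fix P v assume P: "P \<in> X" and v: "\<forall>l. v l \<in> P l"
    then have "v l \<in> proportional (n l) `` {w P}" using w(2) by blast
    then obtain c where c: "c \<noteq> 0" "\<And>m. v l m = c * w P m" by (auto simp: proportional_def)
    have "eval_at v (linear_form n l a) = c * (\<Sum>m\<le>n l. a m * w P m)"
      by (simp add: linear_form_def eval_at_sum eval_at_scale eval_at_var c(2) sum_distrib_left ac_simps)
    with c(1) a P show "eval_at v (linear_form n l a) \<noteq> 0" by simp
  qed
  with that show ?thesis by blast
qed

lemma avoids_cancel:
  assumes "avoids h X" "f \<in> graded n i" "\<And>P. P \<in> X \<Longrightarrow> vanishes_at (h * f) P"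
  shows "f \<in> point_ideal_part n X i"
  using assms by (auto simp: point_ideal_part_eq avoids_def vanishes_at_def eval_at_mult)

text \<open>
  Multiplication by \<open>h\<close> is injective on \<open>R / I\<close>, so it is an isomorphism between two
  graded pieces of the same dimension \<open>card X\<close>.
\<close>

lemma graded_eq_part_plus_mult:
  fixes X :: "('k::finite \<Rightarrow> (nat \<Rightarrow> 'a::field) set) set"
  assumes X: "generic_position n X" and h: "h \<in> graded n e" "avoids h X"
    and N: "card X \<le> NN n i" and f: "f \<in> graded n (e + i)"
  obtains a b where "a \<in> point_ideal_part n X (e + i)" "b \<in> graded n i" "f = a + h * b"
proof -
  obtain F :: "('k, 'a) mpoly set" where F: "finite F" "graded n i \<subseteq> mpoly_vs.span F"
    by (rule finite_span_graded)
  obtain F' :: "('k, 'a) mpoly set" where F': "finite F'" "graded n (e + i) \<subseteq> mpoly_vs.span F'"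
    by (rule finite_span_graded)
  have sub: "point_ideal_part n X j \<subseteq> graded n j" for j
    by (simp add: point_ideal_part_def)
  obtain B where B: "B \<subseteq> graded n i" "mpoly_vs.indep_mod (point_ideal_part n X i) B"
    "card B + mpoly_vs.dim (point_ideal_part n X i) = mpoly_vs.dim (graded n i :: ('k, 'a) mpoly set)"
    using mpoly_vs.indep_mod_exists[OF subspace_point_ideal_part sub F(2,1)] by blast
  have cardB: "card B = card X"
    using B(3) generic_position_dim[OF X, of i] N by (simp add: dim_graded)
  have finB: "finite B" using B(2) by (simp add: mpoly_vs.indep_mod_def)
  have hsum: "(\<Sum>b\<in>B. scale (c b) (h * b)) = h * (\<Sum>b\<in>B. scale (c b) b)" for c
    by (simp add: sum_distrib_left scale_mult_right)
  have Bgr: "(\<Sum>b\<in>B. scale (c b) b) \<in> graded n i" for c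
    using B(1) by (intro mpoly_vs.subspace_sum mpoly_vs.subspace_scale subspace_graded) auto
  \<comment> \<open>Cancelling \<open>h\<close> turns a relation among the products into one among
    the elements of \<open>B\<close>, which are independent modulo the ideal.\<close>
  have coeff: "c b = 0"
    if "(\<Sum>b\<in>B. scale (c b) (h * b)) \<in> point_ideal_part n X (e + i)" "b \<in> B" for c b
  proof -
    have "(\<Sum>b\<in>B. scale (c b) b) \<in> point_ideal_part n X i"
      using that(1) unfolding hsum by (intro avoids_cancel[OF h(2) Bgr]) (simp add: point_ideal_part_eq)
    with B(2) that(2) show ?thesis by (simp add: mpoly_vs.indep_mod_def)
  qed
  have im: "inj_on (\<lambda>b. h * b) B" "mpoly_vs.indep_mod (point_ideal_part n X (e + i)) ((\<lambda>b. h * b) ` B)"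
    by (rule mpoly_vs.indep_mod_image[OF finB subspace_point_ideal_part]; use coeff in blast)+
  have im_sub: "(\<lambda>b. h * b) ` B \<subseteq> graded n (e + i)"
    using B(1) h(1) by (auto intro: graded_mult)
  \<comment> \<open>By generic position the quotient in degree \<open>e + i\<close> has dimension at
    most \<open>card X\<close>, the size of \<open>B\<close>, so the products span it.\<close>
  have "mpoly_vs.dim (graded n (e + i) :: ('k, 'a) mpoly set)
      \<le> card ((\<lambda>b. h * b) ` B) + mpoly_vs.dim (point_ideal_part n X (e + i))"
    using generic_position_dim[OF X, of "e + i"] card_image[OF im(1)] cardB by (simp add: dim_graded)
  from mpoly_vs.indep_mod_spanning[OF subspace_point_ideal_part sub F'(2,1) im(2) im_sub this f]
  obtain c where "f - (\<Sum>b\<in>(\<lambda>b. h * b) ` B. scale (c b) b) \<in> point_ideal_part n X (e + i)"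
    by blast
  then have "f - h * (\<Sum>b\<in>B. scale (c (h * b)) b) \<in> point_ideal_part n X (e + i)"
    by (simp add: sum.reindex[OF im(1)] hsum)
  with that[OF this Bgr] show ?thesis by simp
qed

lemma NN_mono: "i \<le> j \<Longrightarrow> NN n i \<le> NN n j"
proof -
  \<comment> \<open>With the lower index made constant, the binomial coefficient is visibly monotone
    in its upper index.\<close>
  have sym: "(m + a) choose a = (m + a) choose m" for m a :: nat
    using binomial_symmetric[of a "m + a"] by simp
  have "(m + a) choose a \<le> (m + b) choose b" if "a \<le> b" for m a b :: nat
    unfolding sym[of m a] sym[of m b] using that by (simp add: binomial_right_mono)
  then show "i \<le> j \<Longrightarrow> NN n i \<le> NN n j"
    unfolding NN_def by (intro prod_mono) (auto simp: le_fun_def)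
qed

text \<open>Two unit steps above \<open>i\<close> are needed so that each reduction leaves an ideal
  element of degree \<open>j\<close> minus one unit vector, hence a decomposable one after
  multiplication. The case \<open>l = m\<close> is included.\<close>

lemma part_eq_decomp_part:
  fixes X :: "('k::finite \<Rightarrow> (nat \<Rightarrow> 'a::field_char_0) set) set"
  assumes X: "generic_position n X" "finite X" "X \<subseteq> multiproj n"
    and N: "card X \<le> NN n i"
    and j: "j = std_basis l + (std_basis m + i)"
  shows "point_ideal_part n X j = decomp_part n X j"
proof
  show "decomp_part n X j \<subseteq> point_ideal_part n X j" by (rule decomp_part_subset)
  obtain a where a: "avoids (linear_form n l a) X" by (rule exists_linear_form_avoids[OF X(2,3)])
  obtain b where b: "avoids (linear_form n m b) X" by (rule exists_linear_form_avoids[OF X(2,3)])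
  define g where "g = linear_form n l a"
  define h where "h = linear_form n m b"
  have g: "g \<in> graded n (std_basis l)" and h: "h \<in> graded n (std_basis m)"
    by (simp_all add: g_def h_def linear_form_graded)
  have jl: "j l \<noteq> 0" "j - std_basis l = std_basis m + i"
    and jm: "j m \<noteq> 0" "j - std_basis m = std_basis l + i"
    by (auto simp: j std_basis_def fun_eq_iff)
  \<comment> \<open>The right-hand side is a subspace, so it suffices to treat a variable of block
    \<open>l\<close> times a form \<open>r\<close>.\<close>
  have "f \<in> {f. \<exists>q\<in>decomp_part n X j. \<exists>c\<in>graded n i. f = q + g * (h * c)}" (is "_ \<in> ?T")
    if f: "f \<in> graded n j" for f
  proof (rule mpoly_vs.span_induct[OF graded_span_var_mult[OF f jl(1)]])
    show "mpoly_vs.subspace {f. f \<in> ?T}"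
      unfolding mpoly_vs.subspace_def
    proof (safe, goal_cases)
      case 1
      show ?case
        by (rule bexI[of _ 0], rule bexI[of _ 0])
          (simp_all add: mpoly_vs.subspace_0 subspace_decomp_part subspace_graded)
    next
      case (2 _ _ q c q' c')
      show ?case
        by (rule bexI[of _ "q + q'"], rule bexI[of _ "c + c'"])
          (use 2 in \<open>simp_all add: mpoly_vs.subspace_add subspace_decomp_part subspace_graded
            distrib_left\<close>)
    next
      case (3 r _ q c)
      show ?case
        by (rule bexI[of _ "scale r q"], rule bexI[of _ "scale r c"])
          (use 3 in \<open>simp_all add: mpoly_vs.subspace_scale subspace_decomp_part subspace_graded
            mpoly_vs.scale_right_distrib scale_mult_right\<close>)
    qed
    fix x :: "('k, 'a) mpoly" assume "x \<in> {var l k * r | k r. k \<le> n l \<and> r \<in> graded n (j - std_basis l)}"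
    then obtain k r where x: "x = var l k * r" "k \<le> n l" "r \<in> graded n (std_basis m + i)"
      unfolding jl by auto
    \<comment> \<open>First \<open>r\<close> is reduced modulo multiples of \<open>h\<close>; then
      the variable times the cofactor \<open>u\<close> is reduced modulo multiples of
      \<open>g\<close>. The two remainders become decomposable on multiplication by the variable and
      by \<open>h\<close>.\<close>
    obtain p u where p: "p \<in> point_ideal_part n X (std_basis m + i)" "u \<in> graded n i" "r = p + h * u"
      by (rule graded_eq_part_plus_mult[OF X(1) h b[folded h_def] N x(3)])
    have "var l k * u \<in> graded n (std_basis l + i)"
      by (rule graded_mult[where n = n, OF graded_var p(2)]) (rule x(2))
    then obtain q c where q: "q \<in> point_ideal_part n X (std_basis l + i)" "c \<in> graded n i"
      "var l k * u = q + g * c"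
      by (rule graded_eq_part_plus_mult[OF X(1) g a[folded g_def] N])
    have "x = (var l k * p + h * q) + g * (h * c)"
    proof -
      have "x = var l k * p + h * (var l k * u)" by (simp add: x(1) p(3) algebra_simps)
      also have "\<dots> = (var l k * p + h * q) + g * (h * c)"
        unfolding q(3) by (simp add: algebra_simps)
      finally show ?thesis .
    qed
    moreover have "var l k * p \<in> decomp_part n X j"
      using x(2) p(1) jl by (intro decomp_part_base) simp_all
    moreover have "h * q \<in> decomp_part n X j"
      unfolding h_def using q(1) jm by (intro linear_form_mult_decomp_part) simp_all
    ultimately show "x \<in> ?T"
      using q(2) mpoly_vs.subspace_add[OF subspace_decomp_part] by blast
  qed
  note split = this
  show "point_ideal_part n X j \<subseteq> decomp_part n X j"
  proof
    fix f assume f: "f \<in> point_ideal_part n X j"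
    from split[OF point_ideal_part_graded[OF f]] obtain q c
      where q: "q \<in> decomp_part n X j" "c \<in> graded n i" "f = q + g * (h * c)" by auto
    have "f - q \<in> point_ideal_part n X j"
      using f q(1) decomp_part_subset[of n X j]
      by (intro mpoly_vs.subspace_diff subspace_point_ideal_part) auto
    \<comment> \<open>Cancelling \<open>g\<close> alone suffices: \<open>h * c\<close> is then in
      the ideal one step below \<open>j\<close>, and \<open>g\<close> is a linear form.\<close>
    then have "h * c \<in> point_ideal_part n X (std_basis m + i)"
      using q(3) by (intro avoids_cancel[OF a[folded g_def]] graded_mult h q(2))
        (simp add: point_ideal_part_eq)
    then have "g * (h * c) \<in> decomp_part n X j"
      unfolding g_def using jl by (intro linear_form_mult_decomp_part) simp_all
    with q show "f \<in> decomp_part n X j"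
      by (simp add: mpoly_vs.subspace_add subspace_decomp_part)
  qed
qed

subsection \<open>The degrees of the generators\<close>

text \<open>Descent to a smaller element of \<open>S\<close> lowers the coordinate sum, so it ends
  at a minimal one.\<close>

lemma minimals_below:
  fixes j :: "'k::finite \<Rightarrow> nat"
  assumes "j \<in> S"
  obtains i where "i \<in> minimals S" "i \<le> j"
proof -
  have "\<exists>i\<in>minimals S. i \<le> j"
    using assms
  proof (induction "\<Sum>l\<in>UNIV. j l" arbitrary: j rule: less_induct)
    case less
    show ?case
    proof (cases "j \<in> minimals S")
      case False
      with less.prems obtain i where i: "i \<in> S" "i \<le> j" "i \<noteq> j" by (auto simp: minimals_def)
      then obtain l where "i l \<noteq> j l" by (auto simp: fun_eq_iff)
      with i(2) have "i l < j l" by (simp add: le_fun_def order_less_le)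
      with i(2) have "(\<Sum>l\<in>UNIV. i l) < (\<Sum>l\<in>UNIV. j l)"
        by (intro sum_strict_mono_ex1) (auto simp: le_fun_def)
      from less.hyps[OF this i(1)] i(2) show ?thesis by (meson order_trans)
    qed auto
  qed
  with that show ?thesis by blast
qed

lemma DD_NN: "i \<in> DD n s \<Longrightarrow> s < NN n i"
  by (simp add: DD_def minimals_def)

lemma DD_minimal: "i \<in> DD n s \<Longrightarrow> j \<le> i \<Longrightarrow> j \<noteq> i \<Longrightarrow> NN n j \<le> s"
  unfolding DD_def minimals_def using not_le by blast

lemma minus_std_basis_less:
  assumes "j l \<noteq> 0"
  shows "j - std_basis l \<le> j" "j - std_basis l \<noteq> j"
proof -
  show "j - std_basis l \<le> j" by (simp add: le_fun_def)
  have "(j - std_basis l) l < j l" using assms by (simp add: std_basis_def)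
  then show "j - std_basis l \<noteq> j" by (metis less_irrefl)
qed

text \<open>Every coordinate of a minimal degree is at most \<open>s\<close>: if
  \<open>i l > s\<close>, lowering it by one still leaves a factor of at least \<open>i l\<close> in
  \<open>NN\<close>, against minimality.\<close>

lemma finite_DD:
  assumes n: "\<And>l. n l \<ge> 1" and s: "s \<ge> 1"
  shows "finite (DD n s)"
proof -
  have "i l \<le> s" if i: "i \<in> DD n s" for i l
  proof (rule ccontr)
    assume "\<not> i l \<le> s"
    then have il: "i l > s" by simp
    let ?k = "i - std_basis l"
    have "NN n ?k \<le> s" using il by (intro DD_minimal[OF i] minus_std_basis_less) simp_all
    \<comment> \<open>Comparison with dimension 1, where the binomial coefficient equals
      \<open>?k l + 1\<close>; this uses \<open>n l \<ge> 1\<close>.\<close>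
    moreover have "?k l + 1 \<le> (n l + ?k l) choose ?k l"
      using binomial_right_mono[of "1 + ?k l" "n l + ?k l" "?k l"] n[of l] by simp
    moreover have "(n l + ?k l) choose ?k l \<le> NN n ?k"
      unfolding NN_def by (intro dvd_imp_le dvd_prodI prod_pos) simp_all
    moreover have "?k l + 1 = i l" using il by (simp add: std_basis_def)
    ultimately show False using il by simp
  qed
  then have "DD n s \<subseteq> PiE UNIV (\<lambda>_. {..s})" by auto
  then show ?thesis by (rule finite_subset) (simp add: finite_PiE)
qed

lemma finite_BD: "finite (DD n s) \<Longrightarrow> finite (BD n s)"
  by (rule finite_subset[of _ "\<Union>l. (\<lambda>i. i + std_basis l) ` DD n s"]) (auto simp: BD_def DD_shift_def)

lemma DD_Int_BD: "DD n s \<inter> BD n s = {}"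
proof (rule ccontr)
  assume "DD n s \<inter> BD n s \<noteq> {}"
  then obtain i l where i: "i \<in> DD n s" "i + std_basis l \<in> DD n s"
    by (auto simp: BD_def DD_shift_def)
  have "i \<le> i + std_basis l" "i \<noteq> i + std_basis l"
    by (auto simp: le_fun_def fun_eq_iff std_basis_def)
  with DD_minimal[OF i(2)] DD_NN[OF i(1)] show False by fastforce
qed

text \<open>Excluded degrees lie at least two unit steps above \<open>i\<close>: one step because
  \<open>j \<noteq> i\<close>, a second because \<open>j\<close> is not \<open>i\<close> plus a unit
  vector. They are the degrees open to the two-step multiplication argument.\<close>

lemma excludedE:
  assumes "j \<in> excluded i"
  obtains l m i' where "i \<le> i'" "j = std_basis l + (std_basis m + i')"
proof -
  have ij: "i \<le> j" "j \<noteq> i" and nb: "\<And>l. j \<noteq> i + std_basis l" using assms by (auto simp: excluded_def)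
  have step: "\<exists>l. k + std_basis l \<le> j" if "k \<le> j" "j \<noteq> k" for k
  proof -
    from that(2) obtain l where "k l \<noteq> j l" by (metis ext)
    with that(1) have "k l < j l" by (simp add: le_fun_def order_less_le)
    with that(1) have "k + std_basis l \<le> j" by (auto simp: le_fun_def std_basis_def)
    then show ?thesis ..
  qed
  from step[OF ij] obtain l where l: "i + std_basis l \<le> j" ..
  from step[OF l nb] obtain m where m: "i + std_basis l + std_basis m \<le> j" ..
  define i' where "i' = j - (std_basis l + std_basis m)"
  have "i k + (std_basis l k + std_basis m k) \<le> j k" for k
    using m by (simp add: le_fun_def add.assoc)
  then have "i k \<le> i' k" "j k = std_basis l k + (std_basis m k + i' k)" for k
    by (simp_all add: i'_def) (metis add_le_imp_le_diff, metis add.assoc add_leD2 le_add_diff_inverse)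
  then have "i \<le> i'" "j = std_basis l + (std_basis m + i')"
    by (simp_all add: le_fun_def fun_eq_iff)
  with that show ?thesis by blast
qed

section \<open>The subspaces \<open>WW n X j\<close> as decomposable parts\<close>

lemma subspace_mult_part: "mpoly_vs.subspace (mult_part n X l i)"
  unfolding mpoly_vs.subspace_def
proof (intro conjI ballI allI)
  note P = subspace_point_ideal_part[of n X i]
  show "0 \<in> mult_part n X l i"
    unfolding mult_part_def mem_Collect_eq
    by (rule exI[of _ "\<lambda>_. 0"]) (simp add: mpoly_vs.subspace_0[OF P])
  fix f g assume "f \<in> mult_part n X l i" "g \<in> mult_part n X l i"
  then obtain u v where "f = (\<Sum>h\<le>n l. u h * var l h)" "\<forall>h\<le>n l. u h \<in> point_ideal_part n X i"
    "g = (\<Sum>h\<le>n l. v h * var l h)" "\<forall>h\<le>n l. v h \<in> point_ideal_part n X i"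
    by (auto simp: mult_part_def)
  then show "f + g \<in> mult_part n X l i"
    unfolding mult_part_def mem_Collect_eq
    by (intro exI[of _ "\<lambda>h. u h + v h"])
      (simp add: distrib_right sum.distrib mpoly_vs.subspace_add[OF P])
next
  fix c f assume "f \<in> mult_part n X l i"
  then obtain u where "f = (\<Sum>h\<le>n l. u h * var l h)" "\<forall>h\<le>n l. u h \<in> point_ideal_part n X i"
    by (auto simp: mult_part_def)
  then show "scale c f \<in> mult_part n X l i"
    unfolding mult_part_def mem_Collect_eq
    by (intro exI[of _ "\<lambda>h. scale c (u h)"])
      (simp add: mpoly_vs.scale_sum_right scale_mult_left
        mpoly_vs.subspace_scale[OF subspace_point_ideal_part])
qed

lemma subspace_WW: "mpoly_vs.subspace (WW n X j)"
  unfolding mpoly_vs.subspace_def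
proof (intro conjI ballI allI)
  note P = subspace_mult_part
  show "0 \<in> WW n X j"
    unfolding WW_def mem_Collect_eq
    by (rule exI[of _ "\<lambda>_. 0"]) (simp add: mpoly_vs.subspace_0[OF P])
  fix f g assume "f \<in> WW n X j" "g \<in> WW n X j"
  then obtain u v where "f = sum u (LL n (card X) j)" "g = sum v (LL n (card X) j)"
    "\<forall>l\<in>LL n (card X) j. u l \<in> mult_part n X l (j - std_basis l)"
    "\<forall>l\<in>LL n (card X) j. v l \<in> mult_part n X l (j - std_basis l)"
    by (auto simp: WW_def)
  then show "f + g \<in> WW n X j"
    unfolding WW_def mem_Collect_eq
    by (intro exI[of _ "\<lambda>l. u l + v l"]) (simp add: sum.distrib mpoly_vs.subspace_add[OF P])
next
  fix c f assume "f \<in> WW n X j"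
  then obtain u where "f = sum u (LL n (card X) j)"
    "\<forall>l\<in>LL n (card X) j. u l \<in> mult_part n X l (j - std_basis l)"
    by (auto simp: WW_def)
  then show "scale c f \<in> WW n X j"
    unfolding WW_def mem_Collect_eq
    by (intro exI[of _ "\<lambda>l. scale c (u l)"])
      (simp add: mpoly_vs.scale_sum_right mpoly_vs.subspace_scale[OF subspace_mult_part])
qed

text \<open>The two spaces differ only in the directions \<open>l\<close> they use. In a direction
  outside \<open>LL\<close> the ideal is zero in degree \<open>j - std_basis l\<close>: otherwise a
  minimal degree would lie strictly below that degree, and \<open>j\<close> would have been
  excluded.\<close>

lemma WW_eq_decomp_part:
  fixes X :: "('k::finite \<Rightarrow> (nat \<Rightarrow> 'a::field) set) set"
  assumes X: "generic_position n X" and j: "j \<in> BD n (card X)"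
  shows "WW n X j = decomp_part n X j"
proof
  have LL: "j l \<noteq> 0" if "l \<in> LL n (card X) j" for l
    using that by (auto simp: LL_def DD_shift_def std_basis_def)
  show "WW n X j \<subseteq> decomp_part n X j"
  proof
    fix f assume "f \<in> WW n X j"
    then obtain w where w: "f = sum w (LL n (card X) j)"
      "\<And>l. l \<in> LL n (card X) j \<Longrightarrow> w l \<in> mult_part n X l (j - std_basis l)"
      by (auto simp: WW_def)
    have "w l \<in> decomp_part n X j" if l: "l \<in> LL n (card X) j" for l
    proof -
      obtain u where u: "w l = (\<Sum>h\<le>n l. u h * var l h)"
        "\<And>h. h \<le> n l \<Longrightarrow> u h \<in> point_ideal_part n X (j - std_basis l)"
        using w(2)[OF l] by (auto simp: mult_part_def)
      show ?thesis
        unfolding u(1) mult.commute[of _ "var _ _"] using u(2) LL[OF l]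
        by (intro mpoly_vs.subspace_sum subspace_decomp_part decomp_part_base) auto
    qed
    then show "f \<in> decomp_part n X j"
      unfolding w(1) by (intro mpoly_vs.subspace_sum subspace_decomp_part)
  qed
  show "decomp_part n X j \<subseteq> WW n X j"
    unfolding decomp_part_def
  proof (rule mpoly_vs.span_minimal[OF _ subspace_WW], safe)
    fix l m f assume m: "m \<le> n l" and jl: "0 < j l"
      and f: "f \<in> point_ideal_part n X (j - std_basis l)"
    show "var l m * f \<in> WW n X j"
    proof (cases "l \<in> LL n (card X) j")
      case True
      have "(\<Sum>h\<le>n l. (if h = m then f else 0) * var l h) = (\<Sum>h\<le>n l. if h = m then f * var l m else 0)"
        by (rule sum.cong) auto
      then have "var l m * f = (\<Sum>h\<le>n l. (if h = m then f else 0) * var l h)"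
        using m by (simp add: mult.commute)
      then have "var l m * f \<in> mult_part n X l (j - std_basis l)"
        unfolding mult_part_def mem_Collect_eq using f
        by (intro exI[of _ "\<lambda>h. if h = m then f else 0"])
          (simp add: mpoly_vs.subspace_0 subspace_point_ideal_part)
      then show ?thesis
        unfolding WW_def mem_Collect_eq
        by (intro exI[of _ "\<lambda>l'. if l' = l then var l m * f else 0"])
          (use True in \<open>auto simp: mpoly_vs.subspace_0 subspace_mult_part\<close>)
    next
      case False
      have jj: "j = (j - std_basis l) + std_basis l"
        using std_basis_add_diff[of j l] jl by (simp add: add.commute)
      have "NN n (j - std_basis l) \<le> card X"
      proof (rule ccontr)
        assume "\<not> ?thesis"
        then have "j - std_basis l \<in> {i. NN n i > card X}" by simp
        then obtain i where i: "i \<in> DD n (card X)" "i \<le> j - std_basis l"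
          unfolding DD_def by (rule minimals_below)
        have "j - std_basis l \<noteq> i"
          \<comment> \<open>If \<open>j - std_basis l\<close> were itself minimal, \<open>l\<close>
            would belong to \<open>LL\<close>.\<close>
          using False i(1) jj by (auto simp: LL_def DD_shift_def)
        moreover have "i \<le> j" using i(2) by (auto simp: le_fun_def intro: order_trans)
        moreover have "j \<noteq> i" 
        proof
          assume "j = i"
          with i(2) have "i l \<le> i l - 1" by (auto simp: le_fun_def std_basis_def dest: spec[of _ l])
          with jl \<open>j = i\<close> show False by simp
        qed
        \<comment> \<open>For \<open>l' \<noteq> l\<close> the entries of \<open>i\<close> and
          \<open>j\<close> at \<open>l\<close> would agree, against
          \<open>i \<le> j - std_basis l\<close>; for \<open>l' = l\<close> one gets
          \<open>i = j - std_basis l\<close>.\<close>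
        moreover have "j \<noteq> i + std_basis l'" for l'
        proof
          assume eq: "j = i + std_basis l'"
          have "l' = l"
          proof (rule ccontr)
            assume "l' \<noteq> l"
            then have "j l = i l" by (simp add: eq std_basis_def)
            moreover have "i l \<le> j l - 1" using i(2) by (auto simp: le_fun_def std_basis_def dest: spec[of _ l])
            ultimately show False using jl by simp
          qed
          with eq \<open>j - std_basis l \<noteq> i\<close> show False by (auto simp: fun_eq_iff)
        qed
        ultimately have "j \<in> excluded i" by (auto simp: excluded_def)
        with j i(1) show False by (auto simp: BD_def)
      qed
      with f generic_position_part_zero[OF X] have "f = 0" by blast
      then show ?thesis by (simp add: mpoly_vs.subspace_0 subspace_WW)
    qed
  qed
qed

section \<open>The generator count: degrees in \<open>DD\<close>, in \<open>BD\<close>, and all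
  others\<close>

theorem theorem4p2:
  fixes n :: "'k::finite \<Rightarrow> nat"
    and X :: "('k \<Rightarrow> (nat \<Rightarrow> 'a::{alg_closed_field, field_char_0}) set) set"
    and s :: nat
  assumes "\<And>l. n l \<ge> 1"
    and "X \<subseteq> multiproj n" and "finite X" and "X \<noteq> {}" and "card X = s"
    and "generic_position n X"
    and "non_degenerate n X"
  shows "int (min_gens n (point_ideal n X)) =
           (\<Sum>i\<in>DD n s. int (mpoly_vs.dim (point_ideal_part n X i))) +
           (\<Sum>j\<in>BD n s. int (mpoly_vs.dim (point_ideal_part n X j)) - int (mpoly_vs.dim (WW n X j))) \<and>
         (\<Sum>i\<in>DD n s. int (mpoly_vs.dim (point_ideal_part n X i))) +
           (\<Sum>j\<in>BD n s. int (mpoly_vs.dim (point_ideal_part n X j)) - int (mpoly_vs.dim (WW n X j))) =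
         (\<Sum>i\<in>DD n s. int (NN n i) - int s) +
           (\<Sum>j\<in>BD n s. int (NN n j) - int s - int (mpoly_vs.dim (WW n X j)))"
proof -
  note X = assms(6) and s = assms(5)
  have "s \<ge> 1" using assms(3-5) by (metis One_nat_def Suc_le_eq card_gt_0_iff)
  then have fin: "finite (DD n s)" by (intro finite_DD assms(1))
  have small: "point_ideal_part n X j = {0}" if "NN n j \<le> s" for j
    using generic_position_part_zero[OF X] that s by simp
  \<comment> \<open>Just below a minimal degree \<open>NN\<close> is at most \<open>s\<close>, so
    the ideal is zero there and nothing of minimal degree is decomposable.\<close>
  have decomp_DD: "decomp_part n X i = {0}" if i: "i \<in> DD n s" for i
  proof -
    have "{var l m * f | l m f. m \<le> n l \<and> i l \<noteq> 0 \<and> f \<in> point_ideal_part n X (i - std_basis l)} \<subseteq> {0}"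
    proof safe
      fix l m f assume "0 < i l" and f: "f \<in> point_ideal_part n X (i - std_basis l)"
      then have "NN n (i - std_basis l) \<le> s"
        by (intro DD_minimal[OF i] minus_std_basis_less) simp_all
      from small[OF this] f show "var l m * f = 0" by simp
    qed
    then show ?thesis
      unfolding decomp_part_def
      using mpoly_vs.span_minimal[OF _ mpoly_vs.subspace_single_0] mpoly_vs.span_zero by blast
  qed
  have rest: "point_ideal_part n X j = decomp_part n X j" if j: "j \<notin> DD n s \<union> BD n s" for j
  proof (cases "NN n j \<le> s")
    case True
    have "0 \<in> decomp_part n X j" by (rule mpoly_vs.subspace_0[OF subspace_decomp_part])
    with small[OF True] decomp_part_subset[of n X j] show ?thesis by auto
  next
    case False
    then have "j \<in> {i. NN n i > s}" by simp
    then obtain i where i: "i \<in> DD n s" "i \<le> j" unfolding DD_def by (rule minimals_below)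
    \<comment> \<open>If \<open>j\<close> is a shift of a minimal degree, it is missing from
      \<open>BD\<close> because some minimal degree, possibly another one, excludes it; if it is no
      shift, the degree \<open>i\<close> below it does.\<close>
    have "\<exists>i\<in>DD n s. j \<in> excluded i"
    proof (cases "j \<in> (\<Union>l. DD_shift n s l)")
      case True
      with j show ?thesis by (auto simp: BD_def)
    next
      case False
      with i j have "j \<in> excluded i" by (auto simp: excluded_def DD_shift_def)
      with i(1) show ?thesis by blast
    qed
    then obtain i where i: "i \<in> DD n s" "j \<in> excluded i" by blast
    obtain l m i' where i': "i \<le> i'" "j = std_basis l + (std_basis m + i')"
      by (rule excludedE[OF i(2)])
    have "card X \<le> NN n i'" using DD_NN[OF i(1)] NN_mono[OF i'(1), of n] s by simp
    from part_eq_decomp_part[OF X assms(3,2) this i'(2)] show ?thesis .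
  qed
  have "int (min_gens n (point_ideal n X)) = (\<Sum>j\<in>DD n s \<union> BD n s.
      int (mpoly_vs.dim (point_ideal_part n X j)) - int (mpoly_vs.dim (decomp_part n X j)))"
    by (rule min_gens_point_ideal) (use fin finite_BD[OF fin] rest in auto)
  also have "\<dots> = (\<Sum>j\<in>DD n s. int (mpoly_vs.dim (point_ideal_part n X j)) - int (mpoly_vs.dim (decomp_part n X j)))
     + (\<Sum>j\<in>BD n s. int (mpoly_vs.dim (point_ideal_part n X j)) - int (mpoly_vs.dim (decomp_part n X j)))"
    by (rule sum.union_disjoint[OF fin finite_BD[OF fin] DD_Int_BD])
  also have "(\<Sum>j\<in>DD n s. int (mpoly_vs.dim (point_ideal_part n X j)) - int (mpoly_vs.dim (decomp_part n X j)))
      = (\<Sum>i\<in>DD n s. int (mpoly_vs.dim (point_ideal_part n X i)))"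
    using mpoly_vs.dim_unique[of "{}" "{0}" 0]
    by (intro sum.cong) (simp_all add: decomp_DD mpoly_vs.independent_empty)
  also have "(\<Sum>j\<in>BD n s. int (mpoly_vs.dim (point_ideal_part n X j)) - int (mpoly_vs.dim (decomp_part n X j)))
      = (\<Sum>j\<in>BD n s. int (mpoly_vs.dim (point_ideal_part n X j)) - int (mpoly_vs.dim (WW n X j)))"
    using WW_eq_decomp_part[OF X] s by (intro sum.cong) simp_all
  finally have first: "int (min_gens n (point_ideal n X)) =
      (\<Sum>i\<in>DD n s. int (mpoly_vs.dim (point_ideal_part n X i))) +
      (\<Sum>j\<in>BD n s. int (mpoly_vs.dim (point_ideal_part n X j)) - int (mpoly_vs.dim (WW n X j)))" .
  \<comment> \<open>Above the threshold the minimum in the Hilbert function is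
    \<open>s\<close>.\<close>
  have dim: "int (mpoly_vs.dim (point_ideal_part n X j)) = int (NN n j) - int s" if "s < NN n j" for j
    using generic_position_dim[OF X, of j] that s by simp
  have BD_NN: "s < NN n j" if "j \<in> BD n s" for j
  proof -
    from that obtain i l where i: "i \<in> DD n s" "j = i + std_basis l"
      by (auto simp: BD_def DD_shift_def)
    then have "i \<le> j" by (simp add: le_fun_def)
    from NN_mono[OF this, of n] DD_NN[OF i(1)] show ?thesis by simp
  qed
  have "(\<Sum>i\<in>DD n s. int (mpoly_vs.dim (point_ideal_part n X i))) = (\<Sum>i\<in>DD n s. int (NN n i) - int s)"
    by (intro sum.cong refl dim DD_NN)
  moreover have "(\<Sum>j\<in>BD n s. int (mpoly_vs.dim (point_ideal_part n X j)) - int (mpoly_vs.dim (WW n X j)))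
      = (\<Sum>j\<in>BD n s. int (NN n j) - int s - int (mpoly_vs.dim (WW n X j)))"
    by (intro sum.cong refl arg_cong2[of _ _ _ _ "(-)"] dim BD_NN)
  ultimately show ?thesis
    by (simp only: first)
qed

end
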